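(* Let $\Gamma=\langle\mathbb{T},\kappa\rangle$ be the group of order $24$ (full symmetry group of the tetrahedron) generated by $$R=\begin{bmatrix}1&0&0\\0&-1&0\\0&0&-1\end{bmatrix},\quad C=\begin{bmatrix}0&1&0\\0&0&1\\1&0&0\end{bmatrix},\quad \kappa=\begin{bmatrix}1&0&0\\0&0&1\\0&1&0\end{bmatrix},$$ acting on $\mathbb{C}^3\cong\mathbb{R}^6$ by these matrices. Then, up to conjugacy in $\Gamma$, all pairs of subgroups $K\subseteq H\subseteq\Gamma$ with $H\neq\mathbf{1}$ that satisfy the conditions (a)–(d) of the $H \bmod K$ theorem occur as spatio-temporal symmetries $H$ and spatial symmetries $K$ of periodic solutions arising through a primary Hopf bifurcation, except for the following two pairs, which do not occur: (1) $H=K=\mathbb{D}_2$, the subgroup generated by $\{R,\kappa\}$; (2) $H=\mathbb{Z}_2(\kappa)=\langle\kappa\rangle$, $K=\mathbf{1}$.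
   Context: Notation: $\mathbf{1}$ is the trivial subgroup; $\mathrm{Fix}(\Sigma)$ is the subspace of points fixed by every element of $\Sigma$; an isotropy subgroup of $\Gamma$ is the stabiliser of some point of $\mathbb{R}^6$; $N(K)$ is the normaliser of $K$ in $\Gamma$. All dimensions are real. Conditions of the $H \bmod K$ theorem for a pair of subgroups $K\subseteq H$ of a finite group $\Gamma$ acting on $\mathbb{R}^n$ ($K$ normal in $H$): (a) $H/K$ is cyclic; (b) $K$ is an isotropy subgroup; (c) $\dim\mathrm{Fix}(K)\ge 2$, and if $\dim\mathrm{Fix}(K)=2$ then either $H=K$ or $H=N(K)$; (d) $H$ fixes (maps to itself) a connected component of $\mathrm{Fix}(K)\setminus L_K$, where $L_K=\bigcup_{\delta\in\Gamma,\ \delta\notin K}\mathrm{Fix}(\delta)\cap\mathrm{Fix}(K)$. Symmetries of a periodic solution: for a periodic solution $x(t)$ of a $\Gamma$-equivariant ODE, the group of spatial symmetries is $K=\{\delta\in\Gamma:\delta x(t)=x(t)\ \forall t\}$ and the group of spatio-temporal symmetries is $H=\{\delta\in\Gamma:\delta\{x(t)\}=\{x(t)\}\}$, where $\{x(t)\}$ is the trajectory as a set. Primary Hopf bifurcation means Hopf bifurcation from the trivial equilibrium (the origin), in the setting of the equivariant Hopf theorem: $\dot x=f(x,\lambda)$ with $f:\mathbb{R}^6\times\mathbb{R}\to\mathbb{R}^6$ smooth and $\Gamma$-equivariant in $x$, so that $f(0,\lambda)=0$; $(df)_{0,\lambda}$ has eigenvalues $\sigma(\lambda)\pm i\rho(\lambda)$,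 each of multiplicity $3$, with $\sigma(0)=0$, $\rho(0)=1$, $\sigma'(0)\neq0$. A pair $(H,K)$ occurs at a primary Hopf bifurcation if for some such family there is a branch of periodic solutions with symmetry groups $H$ and $K$ that bifurcates from the origin at $\lambda=0$, with amplitude tending to $0$ and period tending to $2\pi$ as $\lambda\to0$ along the branch (branches with four-dimensional fixed-point space for their symmetry group in $\Gamma\times\mathbb{S}^1$ are allowed; here $\theta\in\mathbb{S}^1$ acts on $\mathbb{C}^3$ as multiplication by $e^{i\theta}$). *)

theory Defs
  imports
    "HOL-Analysis.Analysis"
    "HOL-Algebra.Elementary_Groups"
    "HOL-Algebra.Group_Action"
    "HOL-Computational_Algebra.Polynomial"
begin

section \<open>Groups of matrices acting on complex vectors\<close>

text \<open>
  The space \<open>complex^'n\<close> is used as the phase space \<open>\<real>\<^sup>2\<^sup>n\<close>: all linear algebra, differentiation and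
  dimension counting below is over the reals, and \<^const>\<open>dim\<close> is the real dimension.
  A matrix group acts on it by \<^term>\<open>(*v)\<close>.
\<close>

definition GL :: "(complex^'n^'n) monoid" where
  "GL = \<lparr>carrier = {A. invertible A}, mult = (**), one = mat 1\<rparr>"

definition mR :: "complex^3^3" where
  "mR = vector [vector [1, 0, 0], vector [0, -1, 0], vector [0, 0, -1]]"

definition mC :: "complex^3^3" where
  "mC = vector [vector [0, 1, 0], vector [0, 0, 1], vector [1, 0, 0]]"

definition mkappa :: "complex^3^3" where
  "mkappa = vector [vector [1, 0, 0], vector [0, 0, 1], vector [0, 1, 0]]"

definition Tetra :: "(complex^3^3) monoid" where
  "Tetra = GL\<lparr>carrier := generate GL {mR, mC, mkappa}\<rparr>"

definition D2 :: "(complex^3^3) set" where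
  "D2 = generate Tetra {mR, mkappa}"

definition Z2_kappa :: "(complex^3^3) set" where
  "Z2_kappa = generate Tetra {mkappa}"

definition trivial_subgroup :: "('a, 'b) monoid_scheme \<Rightarrow> 'a set" where
  "trivial_subgroup G = {\<one>\<^bsub>G\<^esub>}"

definition Fix :: "(complex^'n^'n) set \<Rightarrow> (complex^'n) set" where
  "Fix S = {x. \<forall>A\<in>S. A *v x = x}"

definition isotropy_subgroup :: "(complex^'n^'n) set \<Rightarrow> (complex^'n^'n) monoid \<Rightarrow> bool" where
  "isotropy_subgroup K G \<longleftrightarrow> (\<exists>x. K = stabilizer G (*v) x)"

definition conjugate_pairs ::
    "('a, 'b) monoid_scheme \<Rightarrow> 'a set \<times> 'a set \<Rightarrow> 'a set \<times> 'a set \<Rightarrow> bool" where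
  "conjugate_pairs G P Q \<longleftrightarrow>
     (\<exists>g\<in>carrier G. fst P = g <#\<^bsub>G\<^esub> fst Q #>\<^bsub>G\<^esub> inv\<^bsub>G\<^esub> g \<and> snd P = g <#\<^bsub>G\<^esub> snd Q #>\<^bsub>G\<^esub> inv\<^bsub>G\<^esub> g)"


section \<open>The conditions of the \<open>H mod K\<close> theorem\<close>

definition L_set :: "(complex^'n^'n) monoid \<Rightarrow> (complex^'n^'n) set \<Rightarrow> (complex^'n) set" where
  "L_set G K = (\<Union>\<delta>\<in>carrier G - K. Fix {\<delta>} \<inter> Fix K)"

definition H_mod_K_conditions ::
    "(complex^'n^'n) monoid \<Rightarrow> (complex^'n^'n) set \<Rightarrow> (complex^'n^'n) set \<Rightarrow> bool" where
  "H_mod_K_conditions G H K \<longleftrightarrow>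
     subgroup H G \<and> subgroup K G \<and> K \<subseteq> H \<and> K \<lhd> G\<lparr>carrier := H\<rparr> \<and>
     cyclic_group (G\<lparr>carrier := H\<rparr> Mod K) \<and>
     isotropy_subgroup K G \<and>
     dim (Fix K) \<ge> 2 \<and> (dim (Fix K) = 2 \<longrightarrow> H = K \<or> H = normalizer G K) \<and>
     (\<exists>C\<in>components (Fix K - L_set G K). \<forall>h\<in>H. (*v) h ` C = C)"


section \<open>Periodic solutions and their symmetries\<close>

definition solution_of :: "('a::real_normed_vector \<Rightarrow> 'a) \<Rightarrow> (real \<Rightarrow> 'a) \<Rightarrow> bool" where
  "solution_of F x \<longleftrightarrow> (\<forall>t. (x has_vector_derivative F (x t)) (at t))"

text \<open>Having a minimal positive period excludes constant functions.\<close>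

definition minimal_period :: "(real \<Rightarrow> 'a) \<Rightarrow> real \<Rightarrow> bool" where
  "minimal_period x T \<longleftrightarrow>
     0 < T \<and> (\<forall>t. x (t + T) = x t) \<and> (\<forall>S. 0 < S \<and> S < T \<longrightarrow> \<not> (\<forall>t. x (t + S) = x t))"

definition spatial_symmetries ::
    "(complex^'n^'n) monoid \<Rightarrow> (real \<Rightarrow> complex^'n) \<Rightarrow> (complex^'n^'n) set" where
  "spatial_symmetries G x = {\<delta>\<in>carrier G. \<forall>t. \<delta> *v x t = x t}"

definition spatiotemporal_symmetries ::
    "(complex^'n^'n) monoid \<Rightarrow> (real \<Rightarrow> complex^'n) \<Rightarrow> (complex^'n^'n) set" where
  "spatiotemporal_symmetries G x = {\<delta>\<in>carrier G. (*v) \<delta> ` range x = range x}"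


section \<open>Smooth maps\<close>

primrec C_k :: "nat \<Rightarrow> ('a::real_normed_vector \<Rightarrow> 'b::real_normed_vector) \<Rightarrow> bool" where
  "C_k 0 f \<longleftrightarrow> continuous_on UNIV f"
| "C_k (Suc k) f \<longleftrightarrow>
     (\<forall>x. f differentiable (at x)) \<and> (\<forall>v. C_k k (\<lambda>x. frechet_derivative f (at x) v))"

text \<open>
  Directional derivatives suffice to describe smoothness because the domain is finite dimensional
  in every use below.
\<close>

definition smooth :: "('a::euclidean_space \<Rightarrow> 'b::real_normed_vector) \<Rightarrow> bool" where
  "smooth f \<longleftrightarrow> (\<forall>k. C_k k f)"


section \<open>Eigenvalues of real-linear maps\<close>

text \<open>
  The vectors \<open>real_basis (i, b)\<close> form the standard real basis \<open>e\<^sub>i, \<i> e\<^sub>i\<close> of \<open>complex^'n\<close>.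
  With respect to it a real-linear endomorphism has a real matrix of size \<open>2n\<close>, whose characteristic
  polynomial is taken over the complex numbers. The qualified name \<open>Polynomial.order\<close> is the root
  multiplicity, as opposed to the order of a group.
\<close>

definition real_basis :: "'n \<times> bool \<Rightarrow> complex^'n" where
  "real_basis p = axis (fst p) (if snd p then \<i> else 1)"

definition real_matrix :: "(complex^'n \<Rightarrow> complex^'n) \<Rightarrow> real^('n \<times> bool)^('n \<times> bool)" where
  "real_matrix L = (\<chi> p q. L (real_basis q) \<bullet> real_basis p)"

definition charpoly :: "real^'m^'m \<Rightarrow> complex poly" where
  "charpoly M = det (mat [:0, 1:] - (\<chi> p q. [:complex_of_real (M $ p $ q):]))"

definition alg_multiplicity :: "complex \<Rightarrow> (complex^'n \<Rightarrow> complex^'n) \<Rightarrow> nat" where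
  "alg_multiplicity \<mu> L = Polynomial.order \<mu> (charpoly (real_matrix L))"


section \<open>Primary Hopf bifurcation\<close>

definition equivariant_family ::
    "(complex^'n^'n) monoid \<Rightarrow> ((complex^'n) \<times> real \<Rightarrow> complex^'n) \<Rightarrow> bool" where
  "equivariant_family G f \<longleftrightarrow>
     (\<forall>\<gamma>\<in>carrier G. \<forall>x \<mu>. f (\<gamma> *v x, \<mu>) = \<gamma> *v f (x, \<mu>))"

text \<open>
  The requirement \<open>f (0, \<mu>) = 0\<close> is not listed since it follows from equivariance under
  \<^const>\<open>Tetra\<close>.
\<close>

definition Hopf_family ::
    "(complex^3^3) monoid \<Rightarrow> ((complex^3) \<times> real \<Rightarrow> complex^3) \<Rightarrow> bool" where
  "Hopf_family G f \<longleftrightarrow>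
     smooth f \<and> equivariant_family G f \<and>
     (\<exists>\<sigma> \<rho> :: real \<Rightarrow> real. \<exists>\<sigma>'.
        (\<forall>\<^sub>F \<mu> in nhds 0.
           alg_multiplicity (Complex (\<sigma> \<mu>) (\<rho> \<mu>))
             (frechet_derivative (\<lambda>x. f (x, \<mu>)) (at 0)) = 3 \<and>
           alg_multiplicity (Complex (\<sigma> \<mu>) (- \<rho> \<mu>))
             (frechet_derivative (\<lambda>x. f (x, \<mu>)) (at 0)) = 3) \<and>
        isCont \<rho> 0 \<and> \<sigma> 0 = 0 \<and> \<rho> 0 = 1 \<and>
        (\<sigma> has_real_derivative \<sigma>') (at 0) \<and> \<sigma>' \<noteq> 0)"

text \<open>
  The bifurcation parameter is written \<open>\<mu>\<close>. A branch is a continuous curve \<open>s \<mapsto> (\<Lambda> s, x s)\<close> of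
  parameter values and periodic solutions. The condition \<open>\<Lambda> s \<noteq> 0\<close> makes \<open>\<mu>\<close> actually tend to \<open>0\<close> along it; it rules out the vertical branches
  at \<open>\<mu> = 0\<close> that degenerate families, such as linear ones, possess.
\<close>

definition periodic_branch ::
    "(complex^3^3) monoid \<Rightarrow> ((complex^3) \<times> real \<Rightarrow> complex^3) \<Rightarrow>
     (complex^3^3) set \<Rightarrow> (complex^3^3) set \<Rightarrow>
     real \<Rightarrow> (real \<Rightarrow> real) \<Rightarrow> (real \<Rightarrow> real) \<Rightarrow> (real \<Rightarrow> real \<Rightarrow> complex^3) \<Rightarrow> bool" where
  "periodic_branch G f H K \<epsilon> \<Lambda> T x \<longleftrightarrow>
     0 < \<epsilon> \<and>
     continuous_on {0<..<\<epsilon>} \<Lambda> \<and> continuous_on {0<..<\<epsilon>} T \<and>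
     continuous_on ({0<..<\<epsilon>} \<times> UNIV) (\<lambda>(s, t). x s t) \<and>
     (\<forall>s\<in>{0<..<\<epsilon>}.
        \<Lambda> s \<noteq> 0 \<and>
        solution_of (\<lambda>y. f (y, \<Lambda> s)) (x s) \<and> minimal_period (x s) (T s) \<and>
        spatiotemporal_symmetries G (x s) = H \<and> spatial_symmetries G (x s) = K) \<and>
     (\<Lambda> \<longlongrightarrow> 0) (at_right 0) \<and>
     (T \<longlongrightarrow> 2 * pi) (at_right 0) \<and>
     uniform_limit UNIV x (\<lambda>t. 0) (at_right 0)"

definition occurs_at_primary_Hopf ::
    "(complex^3^3) monoid \<Rightarrow> (complex^3^3) set \<Rightarrow> (complex^3^3) set \<Rightarrow> bool" where
  "occurs_at_primary_Hopf G H K \<longleftrightarrow>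
     (\<exists>f \<epsilon> \<Lambda> T x. Hopf_family G f \<and> periodic_branch G f H K \<epsilon> \<Lambda> T x)"

end

theory Submission
  imports Defs
begin

text \<open>
  Existence. In the family \<open>f (x, \<mu>) = (\<mu> - |x|\<^sup>2) x + \<i> x\<close> every \<open>v \<noteq> 0\<close> carries the branch
  \<open>x\<^sub>s t = s e\<^sup>i\<^sup>t v\<close>, whose spatial symmetries fix \<open>v\<close> and whose spatio-temporal symmetries map \<open>v\<close>
  to a unit multiple of itself. So each admissible pair only needs a vector with these two
  stabilizers, for instance \<open>(0, 1, 1)\<close> for \<open>H = D2\<close>, \<open>K = Z2_kappa\<close> and \<open>(1, \<omega>, \<omega>\<^sup>2)\<close> with
  \<open>\<omega>\<^sup>3 = 1\<close> for the cyclic group of order 3.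

  Nonexistence. The linearization \<open>L\<close> at \<open>0\<close>, \<open>\<mu> = 0\<close> commutes with the group, hence acts by one real
  2-by-2 matrix on all three coordinates, and the eigenvalues \<open>\<plusminus>\<i>\<close> force \<open>L\<^sup>2 = -1\<close>. The difference \<open>d\<close>
  of two small solutions satisfies \<open>d' = L d\<close> up to a small multiple of \<open>|d|\<close>; as \<open>e\<^sup>L\<^sup>\<pi> = -1\<close>, it vanishes
  if it has half the period \<open>T\<close>, which is close to \<open>2\<pi>\<close>. For \<open>H = K = D2\<close> compare \<open>x t\<close> with
  \<open>diag (-1, -1, 1) x (t + T/2)\<close>; this shows that \<open>H\<close> is larger. For \<open>H = Z2_kappa\<close>, \<open>K = 1\<close> one has
  \<open>\<kappa> x t = x (t + T/2)\<close>; compare \<open>x t\<close> with \<open>R \<kappa> x t\<close>, so that \<open>K\<close> contains \<open>R \<kappa>\<close>.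
\<close>

section \<open>Algebraic multiplicities\<close>

text \<open>Entries come from any integral domain because the same block shape is needed over
  \<open>complex poly\<close>. An index is a complex coordinate together with its real or imaginary
  part, as in \<open>real_basis\<close>.\<close>

definition block :: "(bool \<Rightarrow> bool \<Rightarrow> 'r::idom) \<Rightarrow> 'r^('n::finite \<times> bool)^('n \<times> bool)" where
  "block m = (\<chi> p q. if fst p = fst q then m (snd p) (snd q) else 0)"

lemma block_mult:
  "block m ** block m' = (block (\<lambda>i j. m i False * m' False j + m i True * m' True j)
     :: 'r::idom^('n::finite \<times> bool)^('n \<times> bool))"
proof -
  have "(\<Sum>k\<in>UNIV. (if a = fst k then m i (snd k) else 0) *
      (if fst k = b then m' (snd k) j else 0)) =
    (if a = b then m i False * m' False j + m i True * m' True j else 0)" for a b :: 'n and i j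
  proof -
    have "(\<Sum>k\<in>UNIV. (if a = fst k then m i (snd k) else 0) *
        (if fst k = b then m' (snd k) j else 0)) =
      (\<Sum>k\<in>UNIV. \<Sum>l\<in>UNIV. (if a = k then (if k = b then m i l * m' l j else 0) else 0))"
      unfolding UNIV_Times_UNIV[symmetric] sum.cartesian_product
      by (rule sum.cong) auto
    also have "\<dots> = (\<Sum>k\<in>UNIV. if a = k then (if k = b then m i False * m' False j + m i True * m' True j else 0) else 0)"
      by (rule sum.cong) (auto simp: UNIV_bool)
    finally show ?thesis by (simp add: sum.delta)
  qed
  then show ?thesis
    by (simp add: block_def matrix_matrix_mult_def vec_eq_iff)
qed

lemma det_block_scalar:
  "det (block (\<lambda>i j. if i = j then c else 0) :: 'r::idom^('n::finite \<times> bool)^('n \<times> bool)) =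
     c ^ (2 * CARD('n))"
proof -
  have "det (block (\<lambda>i j. if i = j then c else 0) :: 'r^('n \<times> bool)^('n \<times> bool)) =
      (\<Prod>p\<in>(UNIV :: ('n \<times> bool) set). c)"
    by (subst det_diagonal) (auto simp: block_def prod_eq_iff)
  then show ?thesis by (simp add: card_cartesian_product UNIV_Times_UNIV[symmetric] mult.commute del: UNIV_Times_UNIV)
qed

text \<open>The adjugate of a 2-by-2 matrix \<open>m\<close> is \<open>J m\<^sup>T J\<^sup>-\<^sup>1\<close> with \<open>J\<close> the quarter turn, so that
  \<open>block m\<close> and its blockwise adjugate have the same determinant.\<close>

lemma det_block_square:
  "(det (block m :: 'r::idom^('n::finite \<times> bool)^('n \<times> bool)))\<^sup>2 =
     (m False False * m True True - m False True * m True False) ^ (2 * CARD('n))"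
proof -
  define J where "J = (\<lambda>i j. if i = j then 0 else if j then 1 else -1 :: 'r)"
  define J' where "J' = (\<lambda>i j. - J i j)"
  let ?B = "block :: (bool \<Rightarrow> bool \<Rightarrow> 'r) \<Rightarrow> 'r^('n \<times> bool)^('n \<times> bool)"
  let ?q = "m False False * m True True - m False True * m True False"
  have tr: "transpose (?B m) = ?B (\<lambda>i j. m j i)"
    by (auto simp: block_def transpose_def vec_eq_iff)
  have "?B J ** ?B J' = ?B (\<lambda>i j. if i = j then 1 else 0)"
    unfolding block_mult by (rule arg_cong[of _ _ block]) (auto simp: J_def J'_def fun_eq_iff)
  then have "det (?B J) * det (?B J') = 1"
    by (simp add: det_mul[symmetric] det_block_scalar)
  moreover have "?B m ** (?B J ** (transpose (?B m) ** ?B J')) = ?B (\<lambda>i j. if i = j then ?q else 0)"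
    unfolding tr block_mult
    by (rule arg_cong[of _ _ block]) (auto simp: J_def J'_def fun_eq_iff algebra_simps)
  from arg_cong[OF this, of det]
  have "det (?B m) * (det (?B J) * (det (?B m) * det (?B J'))) = ?q ^ (2 * CARD('n))"
    by (simp only: det_mul det_transpose det_block_scalar)
  then have "(det (?B m))\<^sup>2 * (det (?B J) * det (?B J')) = ?q ^ (2 * CARD('n))"
    by (simp only: power2_eq_square mult_ac)
  ultimately show ?thesis by simp
qed

text \<open>The matrix \<open>x - M\<close> is again of block shape, so
  \<open>det_block_square\<close> applies over polynomials. Knowing the square is enough: it doubles
  the order of every root on both sides.\<close>

lemma charpoly_block:
  "(charpoly (block m :: real^('n::finite \<times> bool)^('n \<times> bool)))\<^sup>2 =
     [:complex_of_real (m False False * m True True - m False True * m True False),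
       - complex_of_real (m False False + m True True), 1:] ^ (2 * CARD('n))"
proof -
  let ?x = "[:0, 1:] :: complex poly"
  let ?c = "\<lambda>i j. [:complex_of_real (m i j):]"
  have "mat ?x - (\<chi> p q. [:complex_of_real ((block m :: real^('n \<times> bool)^('n \<times> bool)) $ p $ q):])
      = block (\<lambda>i j. (if i = j then ?x else 0) - ?c i j)"
    by (auto simp: vec_eq_iff mat_def block_def prod_eq_iff)
  then show ?thesis
    unfolding charpoly_def by (simp add: det_block_square algebra_simps)
qed

definition diagonal_action :: "(complex \<Rightarrow> complex) \<Rightarrow> complex^'n \<Rightarrow> complex^'n" where
  "diagonal_action A x = (\<chi> i. A (x $ i))"

lemma real_matrix_diagonal_action:
  assumes "linear A"
  shows "real_matrix (diagonal_action A :: complex^'n \<Rightarrow> complex^'n) =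
    block (\<lambda>i j. A (if j then \<i> else 1) \<bullet> (if i then \<i> else 1))"
proof -
  have [simp]: "A 0 = 0" using assms by (rule linear_0)
  have [simp]: "diagonal_action A (axis k z) = axis k (A z)" for k :: 'n and z
    by (auto simp: diagonal_action_def axis_def vec_eq_iff)
  show ?thesis
    by (auto simp: real_matrix_def real_basis_def block_def vec_eq_iff inner_axis_axis)
qed

text \<open>The quadratic is the characteristic polynomial of \<open>A\<close> on the real plane.
  Orders of \<open>\<mu>\<close> are compared in the squared identity and then halved.\<close>

lemma alg_multiplicity_diagonal_action:
  assumes "linear A"
  shows "alg_multiplicity \<mu> (diagonal_action A :: complex^'n \<Rightarrow> complex^'n) = CARD('n) * Polynomial.order \<mu>
    [:complex_of_real (Re (A 1) * Im (A \<i>) - Re (A \<i>) * Im (A 1)),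
      - complex_of_real (Re (A 1) + Im (A \<i>)), 1:]" (is "_ = _ * Polynomial.order \<mu> ?q")
proof -
  have ord: "Polynomial.order \<mu> (p ^ n) = n * Polynomial.order \<mu> p" if "p \<noteq> 0"
    for n and p :: "complex poly"
    using that by (induction n) (auto simp: order_mult)
  let ?p = "charpoly (real_matrix (diagonal_action A :: complex^'n \<Rightarrow> complex^'n))"
  have sq: "?p\<^sup>2 = ?q ^ (2 * CARD('n))"
    unfolding real_matrix_diagonal_action[OF assms] charpoly_block by (simp add: inner_complex_def)
  have "?p \<noteq> 0"
  proof
    assume "?p = 0"
    then have "?q ^ (2 * CARD('n)) = 0" using sq by simp
    then show False by simp
  qed
  then have "2 * Polynomial.order \<mu> ?p = 2 * CARD('n) * Polynomial.order \<mu> ?q"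
    using arg_cong[OF sq, of "Polynomial.order \<mu>"] by (simp add: ord)
  then show ?thesis by (simp add: alg_multiplicity_def)
qed

text \<open>The quadratic of multiplication by \<open>c\<close> splits into \<open>x - c\<close> and
  \<open>x - cnj c\<close>, and these are distinct because \<open>c\<close> is not real.\<close>

lemma alg_multiplicity_scalar_mult:
  fixes c :: complex
  assumes "Im c \<noteq> 0" "\<mu> = c \<or> \<mu> = cnj c"
  shows "alg_multiplicity \<mu> ((*s) c :: complex^'n \<Rightarrow> complex^'n) = CARD('n)"
proof -
  have "(*s) c = (diagonal_action ((*) c) :: complex^'n \<Rightarrow> complex^'n)"
    by (auto simp: diagonal_action_def fun_eq_iff vec_eq_iff)
  moreover have "linear ((*) c)" by (rule linearI) (auto simp: algebra_simps)
  moreover have "[:complex_of_real (Re (c * 1) * Im (c * \<i>) - Re (c * \<i>) * Im (c * 1)),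
      - complex_of_real (Re (c * 1) + Im (c * \<i>)), 1:] = [:- c, 1:] * [:- cnj c, 1:]"
    by (simp add: complex_eq_iff)
  moreover have "Polynomial.order \<mu> ([:- c, 1:] * [:- cnj c, 1:]) = 1"
  proof -
    have "c \<noteq> cnj c" using assms(1) by (simp add: complex_eq_iff)
    have "poly ([:- c, 1:] * [:- cnj c, 1:]) \<mu> = 0" using assms(2) by auto
    moreover have "Polynomial.order a [:- b, 1:] = (if a = b then 1 else 0)" for a b :: complex
      using order_power_n_n[of b 1] by (auto simp: order_0I)
    ultimately show ?thesis using assms(2) \<open>c \<noteq> cnj c\<close>
      by (subst order_mult) (auto simp: pCons_eq_0_iff)
  qed
  ultimately show ?thesis by (simp add: alg_multiplicity_diagonal_action)
qed

text \<open>A root \<open>\<i>\<close> of a monic quadratic with real coefficients forces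
  determinant 1 and trace 0; the conclusion is then Cayley-Hamilton, carried out in
  coordinates.\<close>

lemma diagonal_action_complex_structure:
  assumes "linear A" "alg_multiplicity \<i> (diagonal_action A :: complex^'n \<Rightarrow> complex^'n) > 0"
  shows "A (A z) = - z"
proof -
  let ?d = "Re (A 1) * Im (A \<i>) - Re (A \<i>) * Im (A 1)" and ?t = "Re (A 1) + Im (A \<i>)"
  have "poly [:complex_of_real ?d, - complex_of_real ?t, 1:] \<i> = 0"
    using assms(2) unfolding alg_multiplicity_diagonal_action[OF assms(1)]
    by (intro order_root[THEN iffD2] disjI2) (metis less_irrefl mult_0_right)
  then have root: "complex_of_real ?d - 1 - \<i> * complex_of_real ?t = 0"
    by (simp add: algebra_simps)
  have det: "?d = 1" using arg_cong[OF root, of Re] by simp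
  have tr: "?t = 0" using arg_cong[OF root, of Im] by simp
  have A: "A z = Re z *\<^sub>R A 1 + Im z *\<^sub>R A \<i>" for z
  proof -
    have "z = Re z *\<^sub>R 1 + Im z *\<^sub>R \<i>" by (simp add: complex_eq_iff)
    then show ?thesis by (metis assms(1) linear_add linear_scale)
  qed
  define a b c d where "a = Re (A 1)" "b = Im (A 1)" "c = Re (A \<i>)" "d = Im (A \<i>)"
  have d: "d = - a" using tr by (simp add: a_b_c_d_def)
  have bc: "c * b = - 1 - a * a" using det d by (simp add: a_b_c_d_def algebra_simps)
  have Ri: "Re (A z) = Re z * a + Im z * c" "Im (A z) = Re z * b + Im z * d" for z
    by (subst A, simp add: a_b_c_d_def)+
  have "a * (a * x) + b * (c * x) = - x" for x
    using arg_cong[OF bc, of "\<lambda>y. y * x"] by (simp add: algebra_simps)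
  from this[of "Re z"] this[of "Im z"] show ?thesis
    by (simp add: complex_eq_iff Ri d algebra_simps)
qed

section \<open>Rotating waves of a radial family\<close>

lemma C_k_Suc_imp: "C_k (Suc k) f \<Longrightarrow> C_k k f"
proof (induction k arbitrary: f)
  case 0
  then show ?case
    by (auto intro!: continuous_at_imp_continuous_on differentiable_imp_continuous_within)
next
  case (Suc k)
  then show ?case by simp
qed

lemma C_k_const: "C_k k (\<lambda>x. c)"
  by (induction k arbitrary: c) auto

lemma C_k_bounded_linear:
  assumes "bounded_linear f"
  shows "C_k k f"
proof (cases k)
  case 0
  then show ?thesis using assms by (simp add: linear_continuous_on)
next
  case (Suc n)
  have "(f has_derivative f) (at x)" for x
    using assms by (rule bounded_linear_imp_has_derivative)
  then have "f differentiable (at x)" "frechet_derivative f (at x) = f" for x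
    by (blast intro: differentiableI frechet_derivative_at[symmetric])+
  then show ?thesis by (simp add: Suc C_k_const)
qed

lemma C_k_add:
  assumes "C_k k f" "C_k k g"
  shows "C_k k (\<lambda>x. f x + g x)"
  using assms
proof (induction k arbitrary: f g)
  case 0
  then show ?case by (simp add: continuous_on_add)
next
  case (Suc k)
  then have d: "f differentiable (at x)" "g differentiable (at x)" for x by auto
  have "frechet_derivative (\<lambda>x. f x + g x) (at x) v =
      frechet_derivative f (at x) v + frechet_derivative g (at x) v" for x v
    using has_derivative_add[OF d[of x, unfolded frechet_derivative_works]]
    by (metis frechet_derivative_at)
  then show ?case
    using d Suc.prems by (simp add: Suc.IH differentiable_add)
qed

text \<open>Product rule: each term of the derivative pairs a derivative with an undifferentiated
  factor, which \<open>C_k_Suc_imp\<close> lowers to the class of the induction hypothesis.\<close>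

lemma C_k_bounded_bilinear:
  assumes "bounded_bilinear B" "C_k k f" "C_k k g"
  shows "C_k k (\<lambda>x. B (f x) (g x))"
  using assms(2,3)
proof (induction k arbitrary: f g)
  case 0
  then show ?case using bounded_bilinear.continuous_on[OF assms(1)] by auto
next
  case (Suc k)
  then have d: "f differentiable (at x)" "g differentiable (at x)" for x by auto
  note D = bounded_bilinear.FDERIV[OF assms(1) d[unfolded frechet_derivative_works]]
  have eq: "frechet_derivative (\<lambda>x. B (f x) (g x)) (at x) v =
      B (f x) (frechet_derivative g (at x) v) + B (frechet_derivative f (at x) v) (g x)" for x v
    by (rule fun_cong[OF frechet_derivative_at[OF D, symmetric]])
  have "C_k k (\<lambda>x. B (f x) (frechet_derivative g (at x) v)
      + B (frechet_derivative f (at x) v) (g x))" for v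
    using Suc.prems by (intro C_k_add Suc.IH C_k_Suc_imp[of k f] C_k_Suc_imp[of k g]) simp_all
  moreover have "(\<lambda>x. B (f x) (g x)) differentiable (at x)" for x
    using D by (auto simp: differentiable_def)
  ultimately show ?case by (simp add: eq)
qed

lemma linear_scalar_mult: "linear ((*s) (c::complex) :: complex^'n \<Rightarrow> complex^'n)"
  by (rule linearI) (auto simp: vec_eq_iff algebra_simps)

lemma bounded_linear_scalar_mult_left: "bounded_linear (\<lambda>c. c *s (v::complex^'n))"
  by (intro linear_conv_bounded_linear[THEN iffD1] linearI) (auto simp: vec_eq_iff algebra_simps)

lemma matrix_vector_mult_scalar: "A *v (c *s x) = c *s (A *v (x::complex^'n))"
  by (simp add: vec_eq_iff matrix_vector_mult_def sum_distrib_left mult_ac)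

lemma matrix_vector_mult_real_scalar: "A *v (r *\<^sub>R x) = r *\<^sub>R (A *v (x::complex^'n))"
  by (simp add: vec_eq_iff matrix_vector_mult_def scaleR_sum_right)

lemma norm_scalar_mult: "norm (c *s (v::complex^'n)) = norm c * norm v"
proof -
  have "norm (c *s v) = sqrt (\<Sum>i\<in>UNIV. (norm c)\<^sup>2 * (norm (v $ i))\<^sup>2)"
    by (simp add: norm_vec_def L2_set_def norm_mult power_mult_distrib)
  then show ?thesis
    by (simp add: norm_vec_def L2_set_def real_sqrt_mult flip: sum_distrib_left)
qed

definition radial_family :: "(complex^3) \<times> real \<Rightarrow> complex^3" where
  "radial_family = (\<lambda>(x, \<mu>). (\<mu> - x \<bullet> x) *\<^sub>R x + \<i> *s x)"

lemma smooth_radial_family: "smooth radial_family"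
proof -
  have "C_k k (\<lambda>z. snd z *\<^sub>R fst z + (- ((fst z \<bullet> fst z) *\<^sub>R fst z)
      + \<i> *s fst z) :: complex^3)" for k
  proof (intro C_k_add)
    have lin: "C_k k fst" "C_k k snd" for k
      by (simp_all add: C_k_bounded_linear bounded_linear_fst bounded_linear_snd)
    show "C_k k (\<lambda>z. snd z *\<^sub>R fst z :: complex^3)"
      by (intro C_k_bounded_bilinear[OF bounded_bilinear_scaleR] lin)
    have "C_k k (\<lambda>z. (fst z \<bullet> fst z) *\<^sub>R (- fst z) :: complex^3)"
      by (intro C_k_bounded_bilinear[OF bounded_bilinear_scaleR]
          C_k_bounded_bilinear[OF bounded_bilinear_inner] lin C_k_bounded_linear
          bounded_linear_minus bounded_linear_fst)
    then show "C_k k (\<lambda>z. - ((fst z \<bullet> fst z) *\<^sub>R fst z) :: complex^3)" by simp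
    show "C_k k (\<lambda>z. \<i> *s fst z :: complex^3)"
      by (intro C_k_bounded_linear bounded_linear_compose[OF _ bounded_linear_fst])
        (simp add: linear_scalar_mult linear_conv_bounded_linear[symmetric])
  qed
  moreover have "radial_family = (\<lambda>z. snd z *\<^sub>R fst z + (- ((fst z \<bullet> fst z) *\<^sub>R fst z)
      + \<i> *s fst z))"
    by (auto simp: radial_family_def scaleR_diff_left)
  ultimately show ?thesis by (simp add: smooth_def)
qed

text \<open>The cubic term does not contribute at the origin. The eigenvalues are therefore
  \<open>Complex \<mu> 1\<close> and its conjugate, which cross the imaginary axis with speed
  1.\<close>

lemma radial_family_derivative:
  "frechet_derivative (\<lambda>x. radial_family (x, \<mu>)) (at 0) = (\<lambda>x. Complex \<mu> 1 *s x)"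
proof -
  have "((\<lambda>x::complex^3. (\<mu> - x \<bullet> x) *\<^sub>R x + \<i> *s x) has_derivative
      (\<lambda>x. \<mu> *\<^sub>R x + \<i> *s x)) (at 0)"
    by (auto intro!: derivative_eq_intros bounded_linear_imp_has_derivative
        simp: linear_scalar_mult linear_conv_bounded_linear[symmetric])
  moreover have "(\<lambda>x::complex^3. \<mu> *\<^sub>R x + \<i> *s x) = (\<lambda>x. Complex \<mu> 1 *s x)"
    by (auto simp: fun_eq_iff vec_eq_iff complex_eq_iff)
  ultimately show ?thesis
    using frechet_derivative_at unfolding radial_family_def by fastforce
qed

text \<open>The parameter \<open>s\<^sup>2 * (v \<bullet> v)\<close> is the squared norm of
  \<open>x s t\<close>, so the radial term vanishes along the curve and only the rotation remains.
  The symmetries of the curve are read off from \<open>v\<close> because matrices commute with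
  complex scalars.\<close>

lemma rotating_wave_branch:
  fixes v :: "complex^3"
  assumes "v \<noteq> 0"
  shows "periodic_branch G radial_family
    {\<delta>\<in>carrier G. \<exists>c. norm c = 1 \<and> \<delta> *v v = c *s v} {\<delta>\<in>carrier G. \<delta> *v v = v}
    1 (\<lambda>s. s\<^sup>2 * (v \<bullet> v)) (\<lambda>s. 2 * pi) (\<lambda>s t. (of_real s * cis t) *s v)"
    (is "periodic_branch G _ ?H ?K _ ?\<Lambda> ?T ?x")
  unfolding periodic_branch_def
proof (intro conjI ballI)
  have cancel: "a *s v = b *s v \<longleftrightarrow> a = b" for a b
    using assms by (simp add: vector_mul_rcancel)
  have norm_x: "norm (?x s t) = \<bar>s\<bar> * norm v" for s t
    by (simp add: norm_scalar_mult norm_mult)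
  have cont: "continuous_on S (\<lambda>z. h z *s v)" if "continuous_on S h" for S :: "'z::topological_space set" and h
    using bounded_linear.continuous_on[OF bounded_linear_scalar_mult_left that] .
  show "continuous_on ({0<..<1} \<times> UNIV) (\<lambda>(s, t). ?x s t)"
    unfolding split_def by (intro cont continuous_intros)
  show "continuous_on {0<..<1} ?\<Lambda>" by (intro continuous_intros)
  show "(?\<Lambda> \<longlongrightarrow> 0) (at_right 0)"
    by (auto intro!: tendsto_eq_intros)
  show "uniform_limit UNIV ?x (\<lambda>t. 0) (at_right 0)"
    unfolding uniform_limit_iff
  proof (intro allI impI)
    fix e :: real assume "e > 0"
    have "((\<lambda>s. \<bar>s\<bar> * norm v) \<longlongrightarrow> 0) (at_right 0)" by (auto intro!: tendsto_eq_intros)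
    then have "\<forall>\<^sub>F s in at_right 0. \<bar>s\<bar> * norm v < e"
      using \<open>e > 0\<close> by (simp add: order_tendstoD)
    then show "\<forall>\<^sub>F s in at_right 0. \<forall>t\<in>UNIV. dist (?x s t) 0 < e"
      by eventually_elim (simp add: norm_x)
  qed
  fix s :: real assume s: "s \<in> {0<..<1}"
  show "?\<Lambda> s \<noteq> 0" using s assms by simp
  show "solution_of (\<lambda>y. radial_family (y, ?\<Lambda> s)) (?x s)"
    unfolding solution_of_def
  proof
    fix t
    have "((\<lambda>t. of_real s * cis t) has_vector_derivative of_real s * (\<i> * cis t)) (at t)"
      by (auto intro!: derivative_eq_intros simp: has_vector_derivative_def scaleR_conv_of_real)
    from bounded_linear.has_vector_derivative[OF bounded_linear_scalar_mult_left this]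
    have "(?x s has_vector_derivative (of_real s * (\<i> * cis t)) *s v) (at t)" .
    moreover have "radial_family (?x s t, ?\<Lambda> s) = (of_real s * (\<i> * cis t)) *s v"
      using norm_x[of s t] by (simp add: radial_family_def dot_square_norm power_mult_distrib mult_ac)
    ultimately show "(?x s has_vector_derivative radial_family (?x s t, ?\<Lambda> s)) (at t)" by simp
  qed
  show "minimal_period (?x s) (2 * pi)"
    unfolding minimal_period_def
  proof (intro conjI allI impI)
    show "?x s (t + 2 * pi) = ?x s t" for t by (simp flip: cis_mult)
    fix S :: real assume S: "0 < S \<and> S < 2 * pi"
    show "\<not> (\<forall>t. ?x s (t + S) = ?x s t)"
    proof
      assume "\<forall>t. ?x s (t + S) = ?x s t"
      then have "?x s (0 + S) = ?x s 0" by blast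
      then have "cis S = 1" using s assms by simp
      then have "cos S = 1" by (metis cis.simps(1) one_complex.simps(1))
      then obtain n :: int where "S = n * 2 * pi" by (auto simp: cos_one_2pi_int)
      then show False using S by (auto simp: zero_less_mult_iff)
    qed
  qed simp
  show "spatial_symmetries G (?x s) = ?K"
  proof -
    have "(\<forall>t. \<delta> *v ?x s t = ?x s t) \<longleftrightarrow> \<delta> *v v = v" for \<delta>
    proof
      assume "\<forall>t. \<delta> *v ?x s t = ?x s t"
      then have "\<delta> *v ?x s 0 = ?x s 0" by blast
      then show "\<delta> *v v = v" using s by (simp add: matrix_vector_mult_scalar vector_mul_lcancel)
    qed (simp add: matrix_vector_mult_scalar)
    then show ?thesis by (auto simp: spatial_symmetries_def)
  qed
  show "spatiotemporal_symmetries G (?x s) = ?H"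
  proof -
    have "(*v) \<delta> ` range (?x s) = range (?x s) \<longleftrightarrow> (\<exists>c. norm c = 1 \<and> \<delta> *v v = c *s v)" for \<delta>
    proof
      assume "(*v) \<delta> ` range (?x s) = range (?x s)"
      then have "\<delta> *v ?x s 0 \<in> range (?x s)" by blast
      then obtain t where "\<delta> *v ?x s 0 = ?x s t" by blast
      then have "of_real s *s (\<delta> *v v) = of_real s *s (cis t *s v)"
        by (simp add: matrix_vector_mult_scalar vector_smult_assoc)
      then have "\<delta> *v v = cis t *s v" using s by (subst (asm) vector_mul_lcancel) simp
      then show "\<exists>c. norm c = 1 \<and> \<delta> *v v = c *s v" by (intro exI[of _ "cis t"]) simp
    next
      assume "\<exists>c. norm c = 1 \<and> \<delta> *v v = c *s v"
      then obtain c where "norm c = 1" "\<delta> *v v = c *s v" by blast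
      \<comment> \<open>A phase \<open>cis a\<close> acts as the time shift by \<open>a\<close>, so
        \<open>\<delta>\<close> maps the trajectory onto itself.\<close>
      then obtain a where a: "c = cis a" using rcis_cmod_Arg[of c] by (metis mult_1 of_real_1 rcis_def)
      have sh: "\<delta> *v ?x s t = ?x s (t + a)" for t
        by (simp add: matrix_vector_mult_scalar \<open>\<delta> *v v = c *s v\<close> a vector_smult_assoc mult_ac
            cis_mult[symmetric])
      have mem: "?x s t \<in> range (?x s)" for t by (rule rangeI)
      have "?x s t = \<delta> *v ?x s (t - a)" for t by (simp only: sh diff_add_cancel)
      then have "?x s t \<in> (*v) \<delta> ` range (?x s)" for t
        using mem by (rule image_eqI)
      moreover have "\<delta> *v ?x s t \<in> range (?x s)" for t
        unfolding sh by (rule mem)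
      ultimately show "(*v) \<delta> ` range (?x s) = range (?x s)" by blast
    qed
    then show ?thesis by (auto simp: spatiotemporal_symmetries_def)
  qed
qed simp_all

section \<open>Nonresonance near half a period\<close>

text \<open>Gronwall argument: the weight \<open>exp (c * t)\<close> makes the squared norm
  nonincreasing for \<open>c = - 2 * C\<close> and nondecreasing for \<open>c = 2 * C\<close>, so
  the zero at \<open>t\<^sub>0\<close> spreads to later and to earlier times. Applied to a
  difference of solutions, this is uniqueness for the initial value problem.\<close>

lemma linear_bound_zero:
  fixes d :: "real \<Rightarrow> 'a::real_inner"
  assumes deriv: "\<And>t. (d has_vector_derivative d' t) (at t)"
    and bound: "\<And>t. norm (d' t) \<le> C * norm (d t)"
    and "d t\<^sub>0 = 0"
  shows "d t = 0"
proof -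
  define g where "g c t = exp (c * t) * (d t \<bullet> d t)" for c t
  have g': "(g c has_real_derivative exp (c * t) * (c * (d t \<bullet> d t) + 2 * (d t \<bullet> d' t))) (at t)"
    for c t
  proof -
    have "((\<lambda>t. d t \<bullet> d t) has_real_derivative 2 * (d t \<bullet> d' t)) (at t)"
      using has_derivative_inner[OF deriv[of t, unfolded has_vector_derivative_def]
          deriv[of t, unfolded has_vector_derivative_def]]
      by (simp add: has_field_derivative_def inner_commute algebra_simps mult_commute_abs)
    then show ?thesis
      unfolding g_def by (auto intro!: derivative_eq_intros simp: algebra_simps)
  qed
  have cs: "\<bar>d t \<bullet> d' t\<bar> \<le> C * (d t \<bullet> d t)" for t
  proof -
    have "\<bar>d t \<bullet> d' t\<bar> \<le> norm (d t) * norm (d' t)" by (rule Cauchy_Schwarz_ineq2)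
    also have "\<dots> \<le> norm (d t) * (C * norm (d t))" using bound by (intro mult_left_mono) auto
    finally show ?thesis by (simp add: dot_square_norm power2_eq_square mult_ac)
  qed
  show ?thesis
  proof (cases "t\<^sub>0 \<le> t")
    case True
    have "g (- 2 * C) t \<le> g (- 2 * C) t\<^sub>0"
    proof (rule DERIV_nonpos_imp_nonincreasing[OF True])
      fix s
      show "\<exists>y. (g (- 2 * C) has_real_derivative y) (at s) \<and> y \<le> 0"
        using cs[of s] g'[of "- 2 * C" s]
        by (intro exI conjI) (auto intro!: mult_nonneg_nonpos simp: abs_le_iff)
    qed
    then show ?thesis by (simp add: g_def assms(3) mult_le_0_iff dot_square_norm)
  next
    case False
    then have "t \<le> t\<^sub>0" by simp
    have "g (2 * C) t \<le> g (2 * C) t\<^sub>0"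
    proof (rule DERIV_nonneg_imp_nondecreasing[OF \<open>t \<le> t\<^sub>0\<close>])
      fix s
      show "\<exists>y. (g (2 * C) has_real_derivative y) (at s) \<and> y \<ge> 0"
        using cs[of s] g'[of "2 * C" s]
        by (intro exI conjI) (auto intro!: mult_nonneg_nonneg simp: abs_le_iff)
    qed
    then show ?thesis by (simp add: g_def assms(3) mult_le_0_iff dot_square_norm)
  qed
qed

text \<open>The flow of \<open>L\<close> is \<open>cos t + sin t L\<close>; it is \<open>-1\<close> at time \<open>\<pi>\<close>, so a small perturbation
  of \<open>d' = L d\<close> has no bounded nonzero solution of period close to \<open>\<pi>\<close>.\<close>

lemma nonresonant_periodic_zero:
  fixes d :: "real \<Rightarrow> 'a::euclidean_space"
  assumes L: "linear L" "\<And>v. L (L v) = - v" "\<And>v. norm (L v) \<le> B * norm v"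
    and deriv: "\<And>t. (d has_vector_derivative d' t) (at t)"
    and near: "\<And>t. norm (d' t - L (d t)) \<le> \<eta> * norm (d t)"
    and bd: "\<And>t. norm (d t) \<le> M\<^sub>0"
    and per: "\<And>t. d (t + S) = d t"
    and S: "0 < S" "S \<le> 4" "cos S + \<bar>sin S\<bar> * B \<le> 0"
    and small: "8 * ((1 + B) * \<eta>) \<le> 1" and "0 \<le> B" "0 \<le> \<eta>"
  shows "d t = 0"
proof -
  \<comment> \<open>The supremum \<open>M\<close> will be shown to satisfy
    \<open>M \<le> M / 2\<close>.\<close>
  define M where "M = (SUP t. norm (d t))"
  have bdd: "bdd_above (range (\<lambda>t. norm (d t)))" using bd by (intro bdd_aboveI) auto
  have M: "norm (d t) \<le> M" for t unfolding M_def by (intro cSUP_upper bdd) simp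
  have "0 \<le> M" using M norm_ge_zero order_trans by blast
  have Lbl: "bounded_linear L" using L(1) by (simp add: linear_conv_bounded_linear)
  have half: "norm (d t) \<le> M / 2" for t
  proof -
    \<comment> \<open>\<open>w\<close> undoes the flow of \<open>L\<close>, whose inverse is
      \<open>cos \<tau> - sin \<tau> L\<close> because \<open>L\<close> squares to -1. The main part
      of the equation cancels, and \<open>w'\<close> contains only the error
      \<open>e\<close>.\<close>
    define w where "w \<tau> = cos \<tau> *\<^sub>R d (t + \<tau>) - sin \<tau> *\<^sub>R L (d (t + \<tau>))" for \<tau>
    define e where "e \<tau> = d' (t + \<tau>) - L (d (t + \<tau>))" for \<tau>
    define w' where "w' \<tau> = cos \<tau> *\<^sub>R e \<tau> - sin \<tau> *\<^sub>R L (e \<tau>)" for \<tau>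
    have w': "(w has_vector_derivative w' \<tau>) (at \<tau>)" for \<tau>
    proof -
      have dt: "((\<lambda>\<tau>. d (t + \<tau>)) has_vector_derivative d' (t + \<tau>)) (at \<tau>)"
      proof -
        have "((\<lambda>\<tau>. t + \<tau>) has_vector_derivative 1) (at \<tau>)"
          by (auto simp: has_vector_derivative_def intro!: derivative_eq_intros)
        from vector_diff_chain_at[OF this deriv] show ?thesis by (simp add: o_def)
      qed
      have Ldt: "((\<lambda>\<tau>. L (d (t + \<tau>))) has_vector_derivative L (d' (t + \<tau>))) (at \<tau>)"
        by (rule bounded_linear.has_vector_derivative[OF Lbl dt])
      have "(w has_vector_derivative (- sin \<tau>) *\<^sub>R d (t + \<tau>) + cos \<tau> *\<^sub>R d' (t + \<tau>)
          - (cos \<tau> *\<^sub>R L (d (t + \<tau>)) + sin \<tau> *\<^sub>R L (d' (t + \<tau>)))) (at \<tau>)"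
        unfolding w_def
        by (rule derivative_eq_intros has_vector_derivative_scaleR dt Ldt refl)+ simp
      moreover have "L (e \<tau>) = L (d' (t + \<tau>)) + d (t + \<tau>)"
        by (simp add: e_def linear_diff[OF L(1)] L(2))
      ultimately show ?thesis by (simp add: w'_def e_def algebra_simps)
    qed
    have norm_w': "norm (w' \<tau>) \<le> (1 + B) * \<eta> * M" for \<tau>
    proof -
      have e: "norm (e \<tau>) \<le> \<eta> * M"
        using near[of "t + \<tau>"] M[of "t + \<tau>"] \<open>0 \<le> \<eta>\<close>
        by (auto simp: e_def intro: order_trans mult_left_mono)
      have "norm (w' \<tau>) \<le> \<bar>cos \<tau>\<bar> * norm (e \<tau>) + \<bar>sin \<tau>\<bar> * norm (L (e \<tau>))"
        unfolding w'_def by (rule order_trans[OF norm_triangle_ineq4]) simp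
      also have "\<dots> \<le> 1 * norm (e \<tau>) + 1 * (B * norm (e \<tau>))"
        using L(3) by (intro add_mono mult_mono) auto
      also have "\<dots> = (1 + B) * norm (e \<tau>)" by (simp add: algebra_simps)
      also have "\<dots> \<le> (1 + B) * (\<eta> * M)" using e \<open>0 \<le> B\<close> by (intro mult_left_mono) auto
      finally show ?thesis by (simp add: mult_ac)
    qed
    have "continuous_on {0..S} w"
      using w' by (meson continuous_at_imp_continuous_on has_vector_derivative_continuous)
    \<comment> \<open>Over a time of at most 4 the error accumulates to at most
      \<open>4 * ((1 + B) * \<eta> * M)\<close>, which \<open>small\<close> bounds by
      \<open>M / 2\<close>.\<close>
    from mvt_general[OF S(1) this w'[unfolded has_vector_derivative_def]]
    obtain \<tau> where "norm (w S - w 0) \<le> norm ((S - 0) *\<^sub>R w' \<tau>)" by blast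
    also have "\<dots> = S * norm (w' \<tau>)" using S(1) by simp
    also have "\<dots> \<le> 4 * ((1 + B) * \<eta> * M)"
      using S norm_w'[of \<tau>] by (intro mult_mono) auto
    also have "\<dots> = 8 * ((1 + B) * \<eta>) * M / 2" by simp
    also have "\<dots> \<le> M / 2" using mult_right_mono[OF small \<open>0 \<le> M\<close>] by linarith
    finally have ws: "norm (w S - w 0) \<le> M / 2" .
    \<comment> \<open>By periodicity the endpoints differ only through the inverse flow at time
      \<open>S\<close>. The hypothesis on \<open>cos S\<close> keeps this flow so close to -1 that
      the difference is at least \<open>norm (d t)\<close>.\<close>
    have "w S - w 0 = - ((1 - cos S) *\<^sub>R d t + sin S *\<^sub>R L (d t))"
      using per[of t] by (simp add: w_def algebra_simps)
    then have "norm (w S - w 0) \<ge> norm ((1 - cos S) *\<^sub>R d t) - norm (sin S *\<^sub>R L (d t))"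
      by (metis norm_diff_ineq norm_minus_cancel)
    moreover have "norm (sin S *\<^sub>R L (d t)) \<le> \<bar>sin S\<bar> * (B * norm (d t))"
      using L(3)[of "d t"] by (simp add: mult_left_mono)
    moreover have "norm ((1 - cos S) *\<^sub>R d t) = (1 - cos S) * norm (d t)" by simp
    moreover have "(cos S + \<bar>sin S\<bar> * B) * norm (d t) \<le> 0"
      using S(3) by (simp add: mult_nonpos_nonneg)
    ultimately have "norm (d t) \<le> norm (w S - w 0)" by (simp add: algebra_simps)
    then show ?thesis using ws by simp
  qed
  have "M \<le> M / 2" unfolding M_def using half by (intro cSUP_least) (auto simp: M_def)
  then have "M \<le> 0" by simp
  then show ?thesis using M[of t] by (metis norm_le_zero_iff order_trans)
qed

text \<open>The estimate compares two points, uniformly in the parameter, with one fixed linear map,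
  as differences of solutions require. It is the mean value inequality for \<open>f - L\<close>,
  whose space derivative is small near the origin by continuity.\<close>

lemma smooth_family_linearization:
  fixes f :: "'a::euclidean_space \<times> real \<Rightarrow> 'b::real_normed_vector"
  assumes "smooth f" "\<eta> > 0"
  defines "L \<equiv> frechet_derivative (\<lambda>x. f (x, 0)) (at 0)"
  shows "linear L"
    and "\<exists>\<delta>>0. \<forall>\<mu> x y. \<bar>\<mu>\<bar> < \<delta> \<longrightarrow> norm x < \<delta> \<longrightarrow> norm y < \<delta> \<longrightarrow>
      norm (f (x, \<mu>) - f (y, \<mu>) - L (x - y)) \<le> \<eta> * norm (x - y)"
    and "((\<lambda>x. f (x, 0)) has_derivative L) (at 0)"
proof -
  define D where "D z = frechet_derivative f (at z)" for z
  have "C_k (Suc 0) f" using assms(1) unfolding smooth_def by blast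
  then have "f differentiable (at z)" and cont: "continuous_on UNIV (\<lambda>z. D z v)" for z v
    by (simp_all only: C_k.simps D_def)
  then have D: "(f has_derivative D z) (at z)" for z
    by (simp add: D_def frechet_derivative_works)
  have partial: "((\<lambda>x. f (x, \<mu>)) has_derivative (\<lambda>h. D (x, \<mu>) (h, 0))) (at x)" for x \<mu>
    by (rule has_derivative_compose[OF _ D, of "\<lambda>x. (x, \<mu>)" "\<lambda>h. (h, 0)"])
      (auto intro!: derivative_eq_intros)
  have L: "L = (\<lambda>h. D (0, 0) (h, 0))"
    unfolding L_def by (rule frechet_derivative_at[OF partial, symmetric])
  then show L_deriv: "((\<lambda>x. f (x, 0)) has_derivative L) (at 0)" using partial by simp
  then show lin: "linear L" by (rule has_derivative_linear)
  \<comment> \<open>The operator norm is estimated by a sum over the basis, so each basis direction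
    may contribute \<open>\<eta> / DIM('a)\<close>.\<close>
  define c where "c = \<eta> / DIM('a)"
  have "c > 0" using assms(2) by (simp add: c_def)
  \<comment> \<open>Smoothness gives continuity of the derivative one direction at a time; the
    finitely many basis directions share a neighbourhood.\<close>
  have "\<forall>\<^sub>F z in nhds (0, 0). \<forall>b\<in>Basis. norm (D z (b, 0) - D (0, 0) (b, 0)) < c"
  proof (rule eventually_ball_finite[OF finite_Basis], rule ballI)
    fix b :: 'a
    have "isCont (\<lambda>z. D z (b, 0)) (0, 0)"
      using cont continuous_on_eq_continuous_at open_UNIV by blast
    from tendstoD[OF isContD[OF this] \<open>c > 0\<close>]
    show "\<forall>\<^sub>F z in nhds (0, 0). norm (D z (b, 0) - D (0, 0) (b, 0)) < c"
      using \<open>c > 0\<close> by (auto simp: eventually_at_filter dist_norm elim!: eventually_mono)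
  qed
  then obtain e where "e > 0" and
    e: "\<And>z b. dist z (0, 0) < e \<Longrightarrow> b \<in> Basis \<Longrightarrow> norm (D z (b, 0) - D (0, 0) (b, 0)) < c"
    unfolding eventually_nhds_metric by blast
  have "norm (f (x, \<mu>) - f (y, \<mu>) - L (x - y)) \<le> \<eta> * norm (x - y)"
    if "\<bar>\<mu>\<bar> < e / 2" "norm x < e / 2" "norm y < e / 2" for \<mu> x y
  proof -
    have "norm ((\<lambda>x. f (x, \<mu>) - L x) x - (\<lambda>x. f (x, \<mu>) - L x) y) \<le> \<eta> * norm (x - y)"
    proof (rule differentiable_bound[of "ball 0 (e / 2)"])
      fix z assume z: "z \<in> ball (0 :: 'a) (e / 2)"
      show "((\<lambda>x. f (x, \<mu>) - L x) has_derivative (\<lambda>h. D (z, \<mu>) (h, 0) - L h)) (at z within ball 0 (e / 2))"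
        using partial[of \<mu> z] linear_imp_has_derivative[OF lin]
        by (intro has_derivative_diff) (auto intro: has_derivative_at_withinI)
      have "dist (z, \<mu>) (0, 0) < e"
        using z that(1) norm_Pair_le[of z \<mu>] by (simp add: dist_norm flip: zero_prod_def)
      note eb = e[OF this]
      have linD: "linear (\<lambda>h. D (z, \<mu>) (h, 0) - L h)"
        using has_derivative_linear[OF partial[of \<mu> z]] lin by (rule linear_compose_sub)
      show "onorm (\<lambda>h. D (z, \<mu>) (h, 0) - L h) \<le> \<eta>"
      proof (rule onorm_le)
        fix h :: 'a
        let ?E = "\<lambda>h. D (z, \<mu>) (h, 0) - L h"
        have "?E h = ?E (\<Sum>b\<in>Basis. (h \<bullet> b) *\<^sub>R b)" by (simp add: euclidean_representation)
        also have "\<dots> = (\<Sum>b\<in>Basis. (h \<bullet> b) *\<^sub>R ?E b)"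
          unfolding linear_sum[OF linD] linear_scale[OF linD] by simp
        also have "norm \<dots> \<le> (\<Sum>b\<in>(Basis :: 'a set). norm h * c)"
        proof (rule sum_norm_le)
          fix b :: 'a assume b: "b \<in> Basis"
          show "norm ((h \<bullet> b) *\<^sub>R ?E b) \<le> norm h * c"
            using eb[OF b] Basis_le_norm[OF b, of h] by (auto simp: L intro!: mult_mono)
        qed
        also have "\<dots> = \<eta> * norm h" by (simp add: c_def)
        finally show "norm (?E h) \<le> \<eta> * norm h" .
      qed
    qed (use that in auto)
    then show ?thesis by (simp add: linear_diff[OF lin] algebra_simps)
  qed
  then show "\<exists>\<delta>>0. \<forall>\<mu> x y. \<bar>\<mu>\<bar> < \<delta> \<longrightarrow> norm x < \<delta> \<longrightarrow> norm y < \<delta> \<longrightarrow>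
      norm (f (x, \<mu>) - f (y, \<mu>) - L (x - y)) \<le> \<eta> * norm (x - y)"
    using \<open>e > 0\<close> by (intro exI[of _ "e / 2"]) auto
qed

section \<open>The tetrahedral group as signed permutations\<close>

text \<open>Row by row, the coefficient and the column of the entry that may be nonzero. In this
  form products and equality reduce to arithmetic of signs and indices, which the simplifier
  decides.\<close>

definition sp :: "complex \<Rightarrow> 3 \<Rightarrow> complex \<Rightarrow> 3 \<Rightarrow> complex \<Rightarrow> 3 \<Rightarrow> complex^3^3" where
  "sp a p b q c r = vector [axis p a, axis q b, axis r c]"

definition sel :: "3 \<Rightarrow> 'a \<Rightarrow> 'a \<Rightarrow> 'a \<Rightarrow> 'a" where
  "sel i x y z = (if i = 1 then x else if i = 2 then y else z)"

lemma sel_simps [simp]: "sel 1 x y z = x" "sel 2 x y z = y" "sel 3 x y z = z"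
  by (simp_all add: sel_def)

lemma sp_apply: "sp a p b q c r *v x = vector [a * x $ p, b * x $ q, c * x $ r]"
proof -
  have "(\<Sum>j\<in>UNIV. axis p a $ j * x $ j) = a * x $ p" for a p
    by (simp add: axis_def if_distrib[of "\<lambda>u. u * _"] cong: if_cong)
  then show ?thesis
    by (simp add: vec_eq_iff forall_3 matrix_vector_mult_def sp_def)
qed

lemma sp_mult:
  "sp a p b q c r ** sp a' p' b' q' c' r' =
    sp (a * sel p a' b' c') (sel p p' q' r') (b * sel q a' b' c') (sel q p' q' r')
       (c * sel r a' b' c') (sel r p' q' r')"
proof -
  have row: "(\<Sum>k\<in>UNIV. axis i u $ k * sp a' p' b' q' c' r' $ k $ j) =
      axis (sel i p' q' r') (u * sel i a' b' c') $ j" for i u j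
    using exhaust_3[of i] by (auto simp: sum_3 sp_def axis_def)
  have "(sp a p b q c r ** B) $ i $ j = (\<Sum>k\<in>UNIV. sp a p b q c r $ i $ k * B $ k $ j)" for B :: "complex^3^3" and i j
    by (simp add: matrix_matrix_mult_def)
  then show ?thesis
    by (simp add: vec_eq_iff[of "_ ** _"] vec_eq_iff[of "(_ ** _) $ _"] forall_3[of "\<lambda>i. \<forall>j. _ i j"] row
        sp_def[of a p] sp_def[of "_ * _"])
qed

text \<open>Nonzero coefficients make the columns recoverable: \<open>axis p 0\<close> does not
  determine \<open>p\<close>.\<close>

lemma sp_eq_iff:
  assumes "a \<noteq> 0" "b \<noteq> 0" "c \<noteq> 0"
  shows "sp a p b q c r = sp a' p' b' q' c' r' \<longleftrightarrow>
    a = a' \<and> p = p' \<and> b = b' \<and> q = q' \<and> c = c' \<and> r = r'"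
  using assms by (auto simp: sp_def vec_eq_iff[of "vector _"] forall_3 axis_eq_axis)

text \<open>The signed permutation matrices whose three signs have product 1; this is why the third
  sign is \<open>a * b\<close>.\<close>

definition tetra :: "(complex^3^3) set" where
  "tetra = {sp a p b q (a * b) r | a p b q r. a \<in> {1, -1} \<and> b \<in> {1, -1} \<and> p \<noteq> q \<and> q \<noteq> r \<and> p \<noteq> r}"

text \<open>One case per permutation, with the signs left symbolic. Most finite checks over the
  group run through this rule.\<close>

lemma tetra_cases [consumes 1, case_names e23 e e12 e13 e123 e132]:
  assumes "g \<in> tetra"
  obtains
      a b where "a = 1 \<or> a = -1" "b = 1 \<or> b = -1" "g = sp a 1 b 3 (a * b) 2"
    | a b where "a = 1 \<or> a = -1" "b = 1 \<or> b = -1" "g = sp a 1 b 2 (a * b) 3"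
    | a b where "a = 1 \<or> a = -1" "b = 1 \<or> b = -1" "g = sp a 2 b 1 (a * b) 3"
    | a b where "a = 1 \<or> a = -1" "b = 1 \<or> b = -1" "g = sp a 3 b 2 (a * b) 1"
    | a b where "a = 1 \<or> a = -1" "b = 1 \<or> b = -1" "g = sp a 2 b 3 (a * b) 1"
    | a b where "a = 1 \<or> a = -1" "b = 1 \<or> b = -1" "g = sp a 3 b 1 (a * b) 2"
proof -
  from assms obtain a p b q r where g: "g = sp a p b q (a * b) r"
    and ab: "a = 1 \<or> a = -1" "b = 1 \<or> b = -1" and d: "p \<noteq> q" "q \<noteq> r" "p \<noteq> r"
    unfolding tetra_def by blast
  have "p = 1 \<and> q = 3 \<and> r = 2 \<or> p = 1 \<and> q = 2 \<and> r = 3 \<or> p = 2 \<and> q = 1 \<and> r = 3 \<or>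
      p = 3 \<and> q = 2 \<and> r = 1 \<or> p = 2 \<and> q = 3 \<and> r = 1 \<or> p = 3 \<and> q = 1 \<and> r = 2"
    using d exhaust_3[of p] exhaust_3[of q] exhaust_3[of r] by auto
  then consider "p = 1" "q = 3" "r = 2" | "p = 1" "q = 2" "r = 3" | "p = 2" "q = 1" "r = 3"
    | "p = 3" "q = 2" "r = 1" | "p = 2" "q = 3" "r = 1" | "p = 3" "q = 1" "r = 2" by blast
  then show thesis
    by cases (use that[OF ab] g in simp_all)
qed

lemma tetraI:
  assumes "a = 1 \<or> a = -1" "b = 1 \<or> b = -1" "c = a * b" "p \<noteq> q" "q \<noteq> r" "p \<noteq> r"
  shows "sp a p b q c r \<in> tetra"
  using assms unfolding tetra_def by blast

lemma mat_1_sp: "mat 1 = sp 1 1 1 2 1 3"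
  by (auto simp: vec_eq_iff forall_3 sp_def mat_def axis_def)

lemma generators_sp: "mR = sp 1 1 (-1) 2 (-1) 3" "mC = sp 1 2 1 3 1 1" "mkappa = sp 1 1 1 3 1 2"
  by (auto simp: vec_eq_iff forall_3 sp_def mR_def mC_def mkappa_def axis_def)

lemma tetra_mult:
  assumes "g \<in> tetra" "h \<in> tetra"
  shows "g ** h \<in> tetra"
proof -
  from assms(2) obtain a p b q r where h: "h = sp a p b q (a * b) r"
    and ab: "a = 1 \<or> a = -1" "b = 1 \<or> b = -1" and d: "p \<noteq> q" "q \<noteq> r" "p \<noteq> r"
    unfolding tetra_def by blast
  from assms(1) show ?thesis
    unfolding h by (cases rule: tetra_cases) (use ab d in \<open>auto simp: sp_mult intro!: tetraI\<close>)
qed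

text \<open>The matrices are orthogonal, and the witnesses are the transposes: each sign moves to
  the row given by its former column.\<close>

lemma tetra_inverse:
  assumes "g \<in> tetra"
  shows "\<exists>h\<in>tetra. h ** g = mat 1"
  using assms
proof (cases rule: tetra_cases)
  case (e23 a b)
  then show ?thesis
    by (intro bexI[of _ "sp a 1 (a * b) 3 b 2"]) (auto simp: sp_mult mat_1_sp intro!: tetraI)
next
  case (e a b)
  then show ?thesis
    by (intro bexI[of _ "sp a 1 b 2 (a * b) 3"]) (auto simp: sp_mult mat_1_sp intro!: tetraI)
next
  case (e12 a b)
  then show ?thesis
    by (intro bexI[of _ "sp b 2 a 1 (a * b) 3"]) (auto simp: sp_mult mat_1_sp intro!: tetraI)
next
  case (e13 a b)
  then show ?thesis
    by (intro bexI[of _ "sp (a * b) 3 b 2 a 1"]) (auto simp: sp_mult mat_1_sp intro!: tetraI)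
next
  case (e123 a b)
  then show ?thesis
    by (intro bexI[of _ "sp (a * b) 3 a 1 b 2"]) (auto simp: sp_mult mat_1_sp intro!: tetraI)
next
  case (e132 a b)
  then show ?thesis
    by (intro bexI[of _ "sp b 2 (a * b) 3 a 1"]) (auto simp: sp_mult mat_1_sp intro!: tetraI)
qed

lemma group_GL: "group (GL :: (complex^'n^'n) monoid)"
proof (rule groupI)
  fix A :: "complex^'n^'n" assume "A \<in> carrier GL"
  then obtain B where "A ** B = mat 1" "B ** A = mat 1"
    by (auto simp: GL_def invertible_def)
  then show "\<exists>B\<in>carrier GL. B \<otimes>\<^bsub>GL\<^esub> A = \<one>\<^bsub>GL\<^esub>"
    by (auto simp: GL_def invertible_def)
next
  show "\<one>\<^bsub>GL\<^esub> \<in> carrier (GL :: (complex^'n^'n) monoid)"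
    by (auto simp: GL_def invertible_def intro: exI[of _ "mat 1"])
qed (auto simp: GL_def invertible_mult matrix_mul_assoc)

lemma one_in_tetra: "mat 1 \<in> tetra"
  unfolding mat_1_sp by (rule tetraI) auto

lemma subgroup_tetra: "subgroup tetra GL"
proof -
  interpret group "GL :: (complex^3^3) monoid" by (rule group_GL)
  have sub: "tetra \<subseteq> carrier GL"
  proof
    fix g assume "g \<in> tetra"
    then obtain h where "h ** g = mat 1" using tetra_inverse by blast
    then show "g \<in> carrier GL" by (auto simp: GL_def invertible_def matrix_left_right_inverse)
  qed
  show ?thesis
  proof (rule subgroupI[OF sub])
    fix g assume g: "g \<in> tetra"
    then obtain h where h: "h \<in> tetra" "h ** g = mat 1" using tetra_inverse by blast
    then have "inv\<^bsub>GL\<^esub> g = h"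
      using g sub by (intro inv_equality) (auto simp: GL_def)
    then show "inv\<^bsub>GL\<^esub> g \<in> tetra" using h by simp
  qed (use one_in_tetra tetra_mult in \<open>auto simp: GL_def\<close>)
qed

text \<open>Every element is a diagonal sign matrix times a permutation matrix, so it suffices to
  generate these two families.\<close>

lemma carrier_Tetra: "carrier Tetra = tetra"
proof -
  interpret group "GL :: (complex^3^3) monoid" by (rule group_GL)
  let ?E = "generate GL {mR, mC, mkappa}"
  have "{mR, mC, mkappa} \<subseteq> tetra"
    by (auto simp: generators_sp intro!: tetraI)
  then have "?E \<subseteq> tetra" by (rule generate_subgroup_incl[OF _ subgroup_tetra])
  moreover have "tetra \<subseteq> ?E"
  proof
    fix g assume g: "g \<in> tetra"
    have m: "A ** B \<in> ?E" if "A \<in> ?E" "B \<in> ?E" for A B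
      using generate.eng[OF that] by (simp add: GL_def)
    have gen: "mR \<in> ?E" "mC \<in> ?E" "mkappa \<in> ?E" by (auto intro: generate.incl)
    have one: "mat 1 \<in> ?E" using generate.one[of GL "{mR, mC, mkappa}"] by (simp add: GL_def)
    have CC: "sp 1 3 1 1 1 2 \<in> ?E"
      using m[OF gen(2) gen(2)] by (simp add: generators_sp sp_mult)
    \<comment> \<open>The permutations are the powers of \<open>mC\<close> and the products of
      \<open>mkappa\<close> with them.\<close>
    have perm: "sp 1 1 1 3 1 2 \<in> ?E" "sp 1 1 1 2 1 3 \<in> ?E" "sp 1 2 1 3 1 1 \<in> ?E" "sp 1 3 1 1 1 2 \<in> ?E"
        "sp 1 2 1 1 1 3 \<in> ?E" "sp 1 3 1 2 1 1 \<in> ?E"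
      using gen one CC m[OF gen(3) gen(2)] m[OF gen(3) CC]
      by (simp_all add: generators_sp sp_mult mat_1_sp)
    \<comment> \<open>Conjugation by the powers of \<open>mC\<close> moves the fixed axis of
      \<open>mR\<close> through the three coordinates.\<close>
    have sign: "sp 1 1 1 2 1 3 \<in> ?E" "sp 1 1 (-1) 2 (-1) 3 \<in> ?E" "sp (-1) 1 (-1) 2 1 3 \<in> ?E"
        "sp (-1) 1 1 2 (-1) 3 \<in> ?E"
      using gen(1) one m[OF m[OF gen(2,1)] CC] m[OF m[OF CC gen(1)] gen(2)]
      by (simp_all add: generators_sp sp_mult mat_1_sp)
    have "sp a 1 b 2 (a * b) 3 \<in> ?E" if "a = 1 \<or> a = -1" "b = 1 \<or> b = -1" for a b
      using that sign by auto
    from m[OF this] have "sp a 1 b 2 (a * b) 3 ** sp 1 p 1 q 1 r \<in> ?E"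
      if "a = 1 \<or> a = -1" "b = 1 \<or> b = -1" "sp 1 p 1 q 1 r \<in> ?E" for a b p q r
      using that by blast
    then have "sp a p b q (a * b) r \<in> ?E"
      if "a = 1 \<or> a = -1" "b = 1 \<or> b = -1" "sp 1 p 1 q 1 r \<in> ?E" for a b p q r
      using that by (simp add: sp_mult)
    with g perm show "g \<in> ?E" by (cases rule: tetra_cases) auto
  qed
  ultimately show ?thesis by (simp add: Tetra_def)
qed

lemma Tetra_simps [simp]:
  "mult Tetra = (**)" "one Tetra = mat 1" "carrier Tetra = tetra"
  by (simp_all add: carrier_Tetra) (simp_all add: Tetra_def GL_def)

lemma group_Tetra: "group Tetra"
proof -
  interpret group "GL :: (complex^3^3) monoid" by (rule group_GL)
  have "group (GL\<lparr>carrier := tetra\<rparr>)" by (rule subgroup_imp_group[OF subgroup_tetra])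
  then show ?thesis using carrier_Tetra by (simp add: Tetra_def)
qed

lemma card_tetra: "card tetra = 24"
proof -
  let ?S = "{(1, 1), (1, -1), (-1, 1), (-1, -1)} :: (complex \<times> complex) set"
  let ?P = "{(1, 2, 3), (1, 3, 2), (2, 1, 3), (2, 3, 1), (3, 1, 2), (3, 2, 1)} :: (3 \<times> 3 \<times> 3) set"
  let ?f = "\<lambda>((a, b), (p, q, r)). sp a p b q (a * b) r"
  have "tetra \<subseteq> ?f ` (?S \<times> ?P)"
  proof
    fix g assume "g \<in> tetra"
    then show "g \<in> ?f ` (?S \<times> ?P)"
      by (cases rule: tetra_cases) (force intro!: image_eqI simp: split_beta)+
  qed
  moreover have "?f ` (?S \<times> ?P) \<subseteq> tetra"
    by (auto intro!: tetraI)
  ultimately have "tetra = ?f ` (?S \<times> ?P)" by (rule subset_antisym)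
  moreover have "inj_on ?f (?S \<times> ?P)"
    unfolding inj_on_def by (auto simp: sp_eq_iff)
  then have "card (?f ` (?S \<times> ?P)) = card (?S \<times> ?P)" by (rule card_image)
  moreover have "card (?S \<times> ?P) = 24" by (simp add: card_cartesian_product)
  ultimately show ?thesis by (simp only:)
qed

lemma tetra_inner:
  assumes "g \<in> tetra"
  shows "(g *v x) \<bullet> (g *v y) = x \<bullet> y"
  using assms by (cases rule: tetra_cases) (auto simp: sp_apply inner_vec_def sum_3)

lemma tetra_norm: "g \<in> tetra \<Longrightarrow> norm (g *v x) = norm x"
  by (simp add: norm_eq_sqrt_inner tetra_inner)

interpretation T: group Tetra by (rule group_Tetra)

abbreviation tinv :: "complex^3^3 \<Rightarrow> complex^3^3" where "tinv g \<equiv> inv\<^bsub>Tetra\<^esub> g"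

lemma tinv [simp]: "g \<in> tetra \<Longrightarrow> tinv g \<in> tetra"
  "g \<in> tetra \<Longrightarrow> tinv g ** g = mat 1" "g \<in> tetra \<Longrightarrow> g ** tinv g = mat 1"
  using T.inv_closed T.l_inv T.r_inv by simp_all

lemma tinv_apply [simp]: "g \<in> tetra \<Longrightarrow> tinv g *v (g *v x) = x"
  "g \<in> tetra \<Longrightarrow> g *v (tinv g *v x) = x"
  by (simp_all add: matrix_vector_mul_assoc)

definition conj_set :: "complex^3^3 \<Rightarrow> (complex^3^3) set \<Rightarrow> (complex^3^3) set" where
  "conj_set g X = (\<lambda>h. g ** h ** tinv g) ` X"

lemma conj_set_coset: "g <#\<^bsub>Tetra\<^esub> X #>\<^bsub>Tetra\<^esub> tinv g = conj_set g X"
  by (auto simp: conj_set_def l_coset_def r_coset_def)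

lemma mem_conj_set:
  assumes "g \<in> tetra"
  shows "h \<in> conj_set g X \<longleftrightarrow> tinv g ** h ** g \<in> X"
proof -
  have "g ** (tinv g ** h ** g) ** tinv g = h"
    using assms by (simp add: matrix_mul_assoc) (simp flip: matrix_mul_assoc)
  moreover have "tinv g ** (g ** k ** tinv g) ** g = k" for k
    using assms by (simp add: matrix_mul_assoc) (simp flip: matrix_mul_assoc)
  ultimately show ?thesis unfolding conj_set_def by (metis (no_types, lifting) image_iff)
qed

lemma conj_set_inverse:
  assumes "g \<in> tetra"
  shows "conj_set g (conj_set (tinv g) X) = X" "conj_set (tinv g) (conj_set g X) = X"
proof -
  have "tinv (tinv g) = g" using assms T.inv_inv by simp
  moreover have "g ** (tinv g ** h ** g) ** tinv g = h" "tinv g ** (g ** h ** tinv g) ** g = h" for h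
    using assms by (simp_all add: matrix_mul_assoc) (simp_all flip: matrix_mul_assoc)
  ultimately show "conj_set g (conj_set (tinv g) X) = X" "conj_set (tinv g) (conj_set g X) = X"
    by (simp_all add: conj_set_def image_image)
qed

section \<open>Rigidity of Hopf branches\<close>

lemma linear_matrix_vector_mult: "linear ((*v) (A :: complex^'n^'n))"
  by (rule linearI) (simp_all add: matrix_vector_right_distrib matrix_vector_mult_real_scalar)

lemma bounded_linear_matrix_vector_mult: "bounded_linear ((*v) (A :: complex^'n^'n))"
  using linear_matrix_vector_mult by (simp add: linear_conv_bounded_linear)

lemma generators_tetra: "mR \<in> tetra" "mC \<in> tetra" "mkappa \<in> tetra"
  by (auto simp: generators_sp intro!: tetraI)

text \<open>The fixed vectors of \<open>mR\<close> form the first coordinate axis, which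
  \<open>L\<close> must preserve; \<open>mC\<close> carries the action on this axis to the other
  two. As \<open>L\<close> is only real-linear, the map on a coordinate need not be a complex
  scalar.\<close>

lemma commuting_linear_diagonal:
  assumes "linear L" "\<And>v. L (mR *v v) = mR *v L v" "\<And>v. L (mC *v v) = mC *v L v"
  shows "L = diagonal_action (\<lambda>z. L (axis 1 z) $ 1)"
proof
  fix v :: "complex^3"
  have ax: "L (axis 1 z) = axis 1 (L (axis 1 z) $ 1)" for z
  proof -
    have "mR *v axis 1 z = axis 1 z"
      by (simp add: generators_sp sp_apply vec_eq_iff forall_3 axis_def)
    then have "mR *v L (axis 1 z) = L (axis 1 z)" using assms(2)[of "axis 1 z"] by simp
    then show ?thesis
      by (auto simp: generators_sp sp_apply vec_eq_iff forall_3 axis_def)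
  qed
  have C: "mC *v axis 1 z = axis 3 z" "mC *v axis 3 z = axis 2 z" for z
    by (simp_all add: generators_sp sp_apply vec_eq_iff forall_3 axis_def)
  have ax3: "L (axis 3 z) = axis 3 (L (axis 1 z) $ 1)" for z
    using assms(3)[of "axis 1 z"] by (metis C(1) ax)
  have ax2: "L (axis 2 z) = axis 2 (L (axis 1 z) $ 1)" for z
    using assms(3)[of "axis 3 z"] by (simp add: C ax3)
  have "v = axis 1 (v $ 1) + axis 2 (v $ 2) + axis 3 (v $ 3)"
    by (simp add: vec_eq_iff forall_3 axis_def)
  from arg_cong[OF this, of L]
  have "L v = L (axis 1 (v $ 1)) + L (axis 2 (v $ 2)) + L (axis 3 (v $ 3))"
    by (simp only: linear_add[OF assms(1)])
  also have "\<dots> = diagonal_action (\<lambda>z. L (axis 1 z) $ 1) v"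
    unfolding ax2 ax3 by (subst ax) (simp add: vec_eq_iff forall_3 axis_def diagonal_action_def)
  finally show "L v = diagonal_action (\<lambda>z. L (axis 1 z) $ 1) v" .
qed

text \<open>Differentiating the equivariance at the origin makes \<open>L\<close> commute with the
  group. So \<open>L\<close> is a single real plane map on all coordinates, and it has the
  eigenvalue \<open>\<i>\<close>.\<close>

lemma Hopf_family_linearization:
  assumes "Hopf_family Tetra f"
  defines "L \<equiv> frechet_derivative (\<lambda>x. f (x, 0)) (at 0)"
  shows "L (L v) = - v"
proof -
  from assms(1) have sm: "smooth f" and eq: "equivariant_family Tetra f"
    and mult: "alg_multiplicity \<i> L > 0"
  proof -
    assume *: "Hopf_family Tetra f"
    then show "smooth f" "equivariant_family Tetra f" by (auto simp: Hopf_family_def)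
    from * obtain \<sigma> \<rho> :: "real \<Rightarrow> real" where "\<sigma> 0 = 0" "\<rho> 0 = 1"
      and ev: "\<forall>\<^sub>F \<mu> in nhds 0. alg_multiplicity (Complex (\<sigma> \<mu>) (\<rho> \<mu>))
             (frechet_derivative (\<lambda>x. f (x, \<mu>)) (at 0)) = 3 \<and>
           alg_multiplicity (Complex (\<sigma> \<mu>) (- \<rho> \<mu>))
             (frechet_derivative (\<lambda>x. f (x, \<mu>)) (at 0)) = 3"
      unfolding Hopf_family_def by blast
    moreover have "Complex 0 1 = \<i>" by (simp add: complex_eq_iff)
    \<comment> \<open>What holds eventually in \<open>nhds 0\<close> holds at 0 itself, where the
      eigenvalue is \<open>Complex 0 1\<close>.\<close>
    ultimately show "alg_multiplicity \<i> L > 0"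
      using eventually_nhds_x_imp_x[OF ev] by (simp add: L_def)
  qed
  have L: "linear L" and D: "((\<lambda>x. f (x, 0)) has_derivative L) (at 0)"
    using smooth_family_linearization(1,3)[OF sm zero_less_one] by (simp_all add: L_def)
  have comm: "L (g *v w) = g *v L w" if "g \<in> tetra" for g w
  proof -
    have g0: "g *v 0 = 0" by simp
    have "((\<lambda>x. f (g *v x, 0)) has_derivative (\<lambda>h. L (g *v h))) (at 0)"
      by (rule has_derivative_compose[OF bounded_linear_imp_has_derivative, of "(*v) g"])
        (use D g0 bounded_linear_matrix_vector_mult in simp_all)
    moreover have "((\<lambda>x. g *v f (x, 0)) has_derivative (\<lambda>h. g *v L h)) (at 0)"
      by (rule bounded_linear.has_derivative[OF bounded_linear_matrix_vector_mult D])
    moreover have "f (g *v x, 0) = g *v f (x, 0)" for x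
      using eq that by (simp add: equivariant_family_def)
    ultimately have "(\<lambda>h. L (g *v h)) = (\<lambda>h. g *v L h)"
      by (auto intro: has_derivative_unique)
    then show ?thesis by (rule fun_cong)
  qed
  define A where "A z = L (axis 1 z) $ 1" for z
  have LA: "L = diagonal_action A"
    using commuting_linear_diagonal[OF L comm comm] generators_tetra by (simp add: A_def[abs_def])
  have "linear A"
  proof (rule linearI)
    have "axis 1 (x + y) = axis 1 x + (axis 1 y :: complex^3)" for x y
      by (simp add: vec_eq_iff forall_3 axis_def)
    then show "A (x + y) = A x + A y" for x y by (simp add: A_def linear_add[OF L])
    have "axis 1 (r *\<^sub>R x) = r *\<^sub>R (axis 1 x :: complex^3)" for r x
      by (simp add: vec_eq_iff forall_3 axis_def)
    then show "A (r *\<^sub>R x) = r *\<^sub>R A x" for r x by (simp add: A_def linear_scale[OF L])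
  qed
  then have "A (A z) = - z" for z
    using diagonal_action_complex_structure mult unfolding LA by blast
  then show ?thesis by (simp add: LA diagonal_action_def vec_eq_iff)
qed

text \<open>One \<open>s\<close> close enough to 0 meets all smallness requirements with
  \<open>S = T s / 2\<close>. The first alternative is uniqueness for equal initial values; the
  second, a difference of period \<open>T s / 2\<close>, is where nonresonance enters.\<close>

lemma Hopf_branch_rigidity:
  assumes f: "Hopf_family Tetra f" and br: "periodic_branch Tetra f H K \<epsilon> \<Lambda> T x"
  shows "\<exists>s\<in>{0<..<\<epsilon>}. \<exists>r. (\<forall>t. norm (x s t) < r) \<and>
    (\<forall>u w. solution_of (\<lambda>y. f (y, \<Lambda> s)) u \<longrightarrow> solution_of (\<lambda>y. f (y, \<Lambda> s)) w \<longrightarrow>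
      (\<forall>t. norm (u t) < r \<and> norm (w t) < r) \<longrightarrow>
      u 0 = w 0 \<or> (\<forall>t. u (t + T s / 2) - w (t + T s / 2) = u t - w t) \<longrightarrow> u = w)"
proof -
  define L where "L = frechet_derivative (\<lambda>x. f (x, 0)) (at 0)"
  have sm: "smooth f" using f by (simp add: Hopf_family_def)
  have L: "linear L" "\<And>v. L (L v) = - v"
    using smooth_family_linearization(1)[OF sm zero_less_one] Hopf_family_linearization[OF f]
    by (simp_all add: L_def)
  obtain B where B: "B > 0" "\<And>v. norm (L v) \<le> B * norm v"
    using bounded_linear.pos_bounded[of L] L(1) by (auto simp: linear_conv_bounded_linear mult.commute)
  \<comment> \<open>Chosen so that \<open>8 * ((1 + B) * \<eta>)\<close> equals 1.\<close>
  define \<eta> where "\<eta> = 1 / (8 * (1 + B))"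
  have "\<eta> > 0" using B by (simp add: \<eta>_def)
  obtain r where "r > 0" and r: "\<And>\<mu> x y. \<bar>\<mu>\<bar> < r \<Longrightarrow> norm x < r \<Longrightarrow> norm y < r \<Longrightarrow>
      norm (f (x, \<mu>) - f (y, \<mu>) - L (x - y)) \<le> \<eta> * norm (x - y)"
    using smooth_family_linearization(2)[OF sm \<open>\<eta> > 0\<close>] unfolding L_def by blast
  have \<epsilon>: "0 < \<epsilon>" and lim: "(\<Lambda> \<longlongrightarrow> 0) (at_right 0)" "(T \<longlongrightarrow> 2 * pi) (at_right 0)"
      "uniform_limit UNIV x (\<lambda>t. 0) (at_right 0)"
    using br by (auto simp: periodic_branch_def)
  have T2: "((\<lambda>s. T s / 2) \<longlongrightarrow> pi) (at_right 0)" using tendsto_divide[OF lim(2) tendsto_const[of 2]] by simp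
  have "\<forall>\<^sub>F s in at_right 0. s \<in> {0<..<\<epsilon>}"
    using \<epsilon> by (rule eventually_at_right_real)
  moreover have "\<forall>\<^sub>F s in at_right 0. \<bar>\<Lambda> s\<bar> < r"
    using tendstoD[OF lim(1) \<open>r > 0\<close>] by simp
  moreover have "\<forall>\<^sub>F s in at_right 0. \<forall>t. norm (x s t) < r"
    using uniform_limitD[OF lim(3) \<open>r > 0\<close>] by simp
  moreover have "\<forall>\<^sub>F s in at_right 0. T s / 2 > 0" "\<forall>\<^sub>F s in at_right 0. T s / 2 < 4"
    using order_tendstoD(1)[OF T2 pi_gt_zero] order_tendstoD(2)[OF T2 pi_less_4] by simp_all
  \<comment> \<open>At \<open>pi\<close> the expression is -1, so it stays negative for half periods
    close to \<open>pi\<close>.\<close>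
  moreover have "((\<lambda>s. cos (T s / 2) + \<bar>sin (T s / 2)\<bar> * B) \<longlongrightarrow> -1) (at_right 0)"
    by (rule tendsto_eq_intros T2 refl | simp)+
  then have "\<forall>\<^sub>F s in at_right 0. cos (T s / 2) + \<bar>sin (T s / 2)\<bar> * B < 0"
    by (rule order_tendstoD) simp
  ultimately have "\<forall>\<^sub>F s in at_right 0. s \<in> {0<..<\<epsilon>} \<and> \<bar>\<Lambda> s\<bar> < r \<and> (\<forall>t. norm (x s t) < r) \<and>
      T s / 2 > 0 \<and> T s / 2 < 4 \<and> cos (T s / 2) + \<bar>sin (T s / 2)\<bar> * B < 0"
    by eventually_elim blast
  then obtain s where s: "s \<in> {0<..<\<epsilon>}" "\<bar>\<Lambda> s\<bar> < r" "\<And>t. norm (x s t) < r"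
      "T s / 2 > 0" "T s / 2 < 4" "cos (T s / 2) + \<bar>sin (T s / 2)\<bar> * B < 0"
    using eventually_happens'[OF trivial_limit_at_right_real] by blast
  have "u t = w t"
    if u: "solution_of (\<lambda>y. f (y, \<Lambda> s)) u" "\<And>t. norm (u t) < r"
      and w: "solution_of (\<lambda>y. f (y, \<Lambda> s)) w" "\<And>t. norm (w t) < r"
      and cases: "(u 0 = w 0) \<or> (\<forall>t. u (t + T s / 2) - w (t + T s / 2) = u t - w t)" for u w t
  proof -
    define d where "d t = u t - w t" for t
    define d' where "d' t = f (u t, \<Lambda> s) - f (w t, \<Lambda> s)" for t
    have deriv: "(d has_vector_derivative d' t) (at t)" for t
      using u(1) w(1) unfolding solution_of_def d_def d'_def
      by (intro has_vector_derivative_diff) auto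
    have near: "norm (d' t - L (d t)) \<le> \<eta> * norm (d t)" for t
      unfolding d_def d'_def by (rule r[OF s(2) u(2) w(2)])
    from cases have "d t = 0"
    proof
      assume "u 0 = w 0"
      then have d0: "d 0 = 0" by (simp add: d_def)
      have "norm (d' t) \<le> (\<eta> + B) * norm (d t)" for t
        using near[of t] B(2)[of "d t"] norm_triangle_sub[of "d' t" "L (d t)"]
        by (simp add: algebra_simps)
      from linear_bound_zero[OF deriv this d0] show ?thesis .
    next
      assume "\<forall>t. u (t + T s / 2) - w (t + T s / 2) = u t - w t"
      then have per: "d (t + T s / 2) = d t" for t by (simp add: d_def)
      have bd: "norm (d t) \<le> r + r" for t
        unfolding d_def using u(2)[of t] w(2)[of t] norm_triangle_ineq4[of "u t" "w t"] by linarith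
      have "8 * ((1 + B) * \<eta>) \<le> 1" using B(1) by (simp add: \<eta>_def)
      from nonresonant_periodic_zero[OF L B(2) deriv near bd per s(4) less_imp_le[OF s(5)]
          less_imp_le[OF s(6)] this] B(1) \<open>\<eta> > 0\<close>
      show ?thesis by simp
    qed
    then show ?thesis by (simp add: d_def)
  qed
  then show ?thesis
    using s(1,3) by (intro bexI[of _ s] exI[of _ r] conjI allI impI ext) auto
qed

lemma solution_of_equivariant:
  assumes "equivariant_family Tetra f" "g \<in> tetra" "solution_of (\<lambda>y. f (y, \<mu>)) x"
  shows "solution_of (\<lambda>y. f (y, \<mu>)) (\<lambda>t. g *v x t)"
  unfolding solution_of_def
proof
  fix t
  have "(x has_vector_derivative f (x t, \<mu>)) (at t)"
    using assms(3) by (simp add: solution_of_def)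
  from bounded_linear.has_vector_derivative[OF bounded_linear_matrix_vector_mult this]
  show "((\<lambda>t. g *v x t) has_vector_derivative f (g *v x t, \<mu>)) (at t)"
    using assms(1,2) by (simp add: equivariant_family_def)
qed

lemma solution_of_shift:
  assumes "solution_of F x"
  shows "solution_of F (\<lambda>t. x (t + a))"
  unfolding solution_of_def
proof
  fix t
  have "((\<lambda>t. t + a) has_vector_derivative 1) (at t)"
    by (auto simp: has_vector_derivative_def intro!: derivative_eq_intros)
  moreover have "(x has_vector_derivative F (x (t + a))) (at (t + a))"
    using assms by (simp add: solution_of_def)
  ultimately show "((\<lambda>t. x (t + a)) has_vector_derivative F (x (t + a))) (at t)"
    using vector_diff_chain_at[of "\<lambda>t. t + a" 1 t x] by (simp add: o_def)
qed

lemma period_int_multiple: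
  fixes T :: real and n :: int
  assumes "\<And>t. x (t + T) = x t"
  shows "x (t + of_int n * T) = x t"
proof -
  have nat: "x (t + of_nat k * T) = x t" for t k
  proof (induction k)
    case (Suc k)
    have "x (t + of_nat (Suc k) * T) = x ((t + of_nat k * T) + T)" by (simp add: algebra_simps)
    then show ?case using assms Suc by simp
  qed simp
  show ?thesis
  proof (cases n)
    case (nonneg k)
    then show ?thesis using nat by simp
  next
    case (neg k)
    have "x t = x ((t + of_int n * T) + of_nat (Suc k) * T)" by (simp add: neg algebra_simps)
    then show ?thesis using nat by metis
  qed
qed

text \<open>The remainder of \<open>S\<close> modulo \<open>T\<close> is again a period below
  \<open>T\<close>, so minimality makes it 0.\<close>

lemma minimal_period_multiple:
  assumes "minimal_period x T" "\<And>t. x (t + S) = x t"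
  obtains n :: int where "S = of_int n * T"
proof -
  have T: "0 < T" "\<And>t. x (t + T) = x t" "\<And>S. 0 < S \<Longrightarrow> S < T \<Longrightarrow> \<not> (\<forall>t. x (t + S) = x t)"
    using assms(1) by (auto simp: minimal_period_def)
  define n where "n = \<lfloor>S / T\<rfloor>"
  define S' where "S' = S - of_int n * T"
  have "x (t + S') = x t" for t
  proof -
    have "x (t + S') = x (t + S' + of_int n * T)" using period_int_multiple[of x T] T(2) by metis
    then show ?thesis by (simp add: S'_def assms(2))
  qed
  moreover have "0 \<le> S'" "S' < T"
    using floor_divide_lower[OF T(1), of S] floor_divide_upper[OF T(1), of S]
    by (simp_all add: S'_def n_def algebra_simps)
  ultimately have "S' = 0" using T(3)[of S'] by force
  then show thesis by (intro that[of n]) (simp add: S'_def)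
qed

section \<open>Stabilizers up to a phase\<close>

definition point_stabilizer :: "complex^3 \<Rightarrow> (complex^3^3) set" where
  "point_stabilizer v = {g \<in> tetra. g *v v = v}"

text \<open>The projection to the matrix group of the isotropy subgroup of \<open>v\<close> in the
  product with the circle.\<close>

definition circle_stabilizer :: "complex^3 \<Rightarrow> (complex^3^3) set" where
  "circle_stabilizer v = {g \<in> tetra. \<exists>c. norm c = 1 \<and> g *v v = c *s v}"

lemma point_stabilizer_image:
  assumes "g \<in> tetra"
  shows "point_stabilizer (g *v v) = conj_set g (point_stabilizer v)"
proof -
  have "h \<in> tetra \<and> h *v (g *v v) = g *v v \<longleftrightarrow>
      tinv g ** h ** g \<in> tetra \<and> (tinv g ** h ** g) *v v = v" for h
  proof -
    have "h = g ** (tinv g ** h ** g) ** tinv g"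
      using assms by (simp add: matrix_mul_assoc) (simp flip: matrix_mul_assoc)
    then have "h \<in> tetra \<longleftrightarrow> tinv g ** h ** g \<in> tetra"
      using assms tetra_mult tinv(1) by metis
    moreover have "(tinv g ** h ** g) *v v = tinv g *v (h *v (g *v v))"
      by (simp add: matrix_vector_mul_assoc matrix_mul_assoc)
    ultimately show ?thesis using assms by (metis tinv_apply)
  qed
  then show ?thesis
    unfolding set_eq_iff mem_conj_set[OF assms] point_stabilizer_def mem_Collect_eq by blast
qed

lemma conj_group_hom: "g \<in> tetra \<Longrightarrow> group_hom Tetra Tetra (\<lambda>h. g ** h ** tinv g)"
proof (unfold_locales, rule homI)
  fix h k assume g: "g \<in> tetra"
  have "g ** h ** tinv g ** (g ** k ** tinv g) = g ** h ** (tinv g ** g) ** k ** tinv g"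
    by (simp only: matrix_mul_assoc)
  then show "g ** (h \<otimes>\<^bsub>Tetra\<^esub> k) ** tinv g = g ** h ** tinv g \<otimes>\<^bsub>Tetra\<^esub> (g ** k ** tinv g)"
    using g by (simp add: matrix_mul_assoc)
qed (simp add: tetra_mult)

lemma generate_conj:
  assumes "g \<in> tetra" "h \<in> tetra"
  shows "generate Tetra {g ** h ** tinv g} = conj_set g (generate Tetra {h})"
  using group_hom.generate_img[OF conj_group_hom[OF assms(1)], of "{h}"] assms(2)
  by (simp add: conj_set_def)

lemma subgroup_conj:
  assumes "g \<in> tetra" "subgroup H Tetra"
  shows "subgroup (conj_set g H) Tetra"
  using group_hom.subgroup_img_is_subgroup[OF conj_group_hom[OF assms(1)] assms(2)]
  by (simp add: conj_set_def)

text \<open>Pattern for computing a generated subgroup as an explicit list: closure of the list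
  bounds the subgroup from above, words in the generators bound it from below.\<close>

lemma generate_Tetra_eqI:
  assumes "X \<subseteq> E" "E \<subseteq> tetra" "mat 1 \<in> E" "\<And>g h. g \<in> E \<Longrightarrow> h \<in> E \<Longrightarrow> g ** h \<in> E"
    "\<And>g. g \<in> E \<Longrightarrow> \<exists>h\<in>E. h ** g = mat 1" "E \<subseteq> generate Tetra X"
  shows "generate Tetra X = E"
proof
  have "subgroup E Tetra"
  proof (rule T.subgroupI)
    fix g assume g: "g \<in> E"
    then obtain h where h: "h \<in> E" "h ** g = mat 1" using assms(5) by blast
    then have "tinv g = h" using assms(2) g by (intro T.inv_equality) auto
    then show "tinv g \<in> E" using h by simp
  qed (use assms in auto)
  then show "generate Tetra X \<subseteq> E" by (rule T.generate_subgroup_incl[OF assms(1)])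
qed fact

lemma generate_Tetra_mult: "A \<in> generate Tetra X \<Longrightarrow> B \<in> generate Tetra X \<Longrightarrow> A ** B \<in> generate Tetra X"
  using generate.eng[of A Tetra X B] by simp

lemma generate_Tetra_one: "mat 1 \<in> generate Tetra X"
  using generate.one[of Tetra X] by simp

section \<open>Generated subgroups as explicit lists\<close>

lemma D2_eq: "D2 = {sp 1 1 1 2 1 3, sp 1 1 (-1) 2 (-1) 3, sp 1 1 1 3 1 2, sp 1 1 (-1) 3 (-1) 2}"
  unfolding D2_def
proof (rule generate_Tetra_eqI)
  have gen: "mR \<in> generate Tetra {mR, mkappa}" "mkappa \<in> generate Tetra {mR, mkappa}"
    by (auto intro: generate.incl)
  show "{sp 1 1 1 2 1 3, sp 1 1 (-1) 2 (-1) 3, sp 1 1 1 3 1 2, sp 1 1 (-1) 3 (-1) 2}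
      \<subseteq> generate Tetra {mR, mkappa}"
    using gen generate_Tetra_one[of "{mR, mkappa}"] generate_Tetra_mult[OF gen]
    by (simp add: generators_sp mat_1_sp sp_mult)
qed (auto simp: generators_sp sp_mult mat_1_sp intro!: tetraI)

lemma Z2_kappa_eq: "Z2_kappa = {sp 1 1 1 2 1 3, sp 1 1 1 3 1 2}"
  unfolding Z2_kappa_def
proof (rule generate_Tetra_eqI)
  have gen: "mkappa \<in> generate Tetra {mkappa}" by (auto intro: generate.incl)
  show "{sp 1 1 1 2 1 3, sp 1 1 1 3 1 2} \<subseteq> generate Tetra {mkappa}"
    using gen generate_Tetra_one[of "{mkappa}"] by (simp add: generators_sp mat_1_sp)
qed (auto simp: generators_sp sp_mult mat_1_sp intro!: tetraI)

lemma generate_mR: "generate Tetra {mR} = {sp 1 1 1 2 1 3, sp 1 1 (-1) 2 (-1) 3}"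
proof (rule generate_Tetra_eqI)
  have gen: "mR \<in> generate Tetra {mR}" by (auto intro: generate.incl)
  show "{sp 1 1 1 2 1 3, sp 1 1 (-1) 2 (-1) 3} \<subseteq> generate Tetra {mR}"
    using gen generate_Tetra_one[of "{mR}"] by (simp add: generators_sp mat_1_sp)
qed (auto simp: generators_sp sp_mult mat_1_sp intro!: tetraI)

text \<open>The two choices of \<open>g\<close> are inverse to each other.\<close>

lemma generate_3cycle:
  assumes "g = sp 1 2 1 3 1 1 \<or> g = sp 1 3 1 1 1 2"
  shows "generate Tetra {g} = {sp 1 1 1 2 1 3, sp 1 2 1 3 1 1, sp 1 3 1 1 1 2}"
proof (rule generate_Tetra_eqI)
  have gen: "g \<in> generate Tetra {g}" by (auto intro: generate.incl)
  show "{sp 1 1 1 2 1 3, sp 1 2 1 3 1 1, sp 1 3 1 1 1 2} \<subseteq> generate Tetra {g}"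
    using gen generate_Tetra_one[of "{g}"] generate_Tetra_mult[OF gen gen] assms
    by (auto simp: mat_1_sp sp_mult)
qed (use assms in \<open>auto simp: sp_mult mat_1_sp intro!: tetraI\<close>)

text \<open>The two choices of \<open>g\<close> are mutually inverse elements of order 4 with square
  \<open>mR\<close>.\<close>

lemma generate_4cycle:
  assumes "g = sp (-1) 1 (-1) 3 1 2 \<or> g = sp (-1) 1 1 3 (-1) 2"
  shows "generate Tetra {g} =
    {sp 1 1 1 2 1 3, sp 1 1 (-1) 2 (-1) 3, sp (-1) 1 (-1) 3 1 2, sp (-1) 1 1 3 (-1) 2}"
proof (rule generate_Tetra_eqI)
  have gen: "g \<in> generate Tetra {g}" by (auto intro: generate.incl)
  note gen2 = generate_Tetra_mult[OF gen gen]
  show "{sp 1 1 1 2 1 3, sp 1 1 (-1) 2 (-1) 3, sp (-1) 1 (-1) 3 1 2, sp (-1) 1 1 3 (-1) 2}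
      \<subseteq> generate Tetra {g}"
    using gen generate_Tetra_one[of "{g}"] gen2 generate_Tetra_mult[OF gen gen2] assms
    by (auto simp: mat_1_sp sp_mult)
qed (use assms in \<open>auto simp: sp_mult mat_1_sp intro!: tetraI\<close>)

section \<open>Stabilizers of test vectors\<close>

lemma vector_3_eq_iff: "vector [a, b, c] = x \<longleftrightarrow> a = x $ 1 \<and> b = x $ 2 \<and> c = (x :: complex^3) $ 3"
  by (simp add: vec_eq_iff forall_3)

lemma point_stabilizer_axis:
  assumes "b \<noteq> 0"
  shows "point_stabilizer (vector [b, 0, 0]) = D2"
proof
  show "point_stabilizer (vector [b, 0, 0]) \<subseteq> D2"
  proof
    fix g assume "g \<in> point_stabilizer (vector [b, 0, 0])"
    then have "g \<in> tetra" "g *v vector [b, 0, 0] = vector [b, 0, 0]"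
      by (auto simp: point_stabilizer_def)
    then show "g \<in> D2"
      using assms by (cases rule: tetra_cases) (auto simp: sp_apply vector_3_eq_iff D2_eq)
  qed
qed (auto simp: D2_eq point_stabilizer_def sp_apply intro!: tetraI)

text \<open>On a diagonal vector the phase must equal all three signs; their product is 1, so the
  phase is 1.\<close>

lemma circle_stabilizer_diagonal:
  assumes "b \<noteq> 0"
  shows "circle_stabilizer (vector [b, b, b]) = point_stabilizer (vector [b, b, b])"
proof
  show "circle_stabilizer (vector [b, b, b]) \<subseteq> point_stabilizer (vector [b, b, b])"
  proof
    fix g assume "g \<in> circle_stabilizer (vector [b, b, b])"
    then obtain c where "g \<in> tetra" "g *v vector [b, b, b] = c *s vector [b, b, b]"
      by (auto simp: circle_stabilizer_def)
    then show "g \<in> point_stabilizer (vector [b, b, b])"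
      using assms by (cases rule: tetra_cases)
        (auto simp: point_stabilizer_def sp_apply vector_3_eq_iff intro!: tetraI)
  qed
  show "point_stabilizer (vector [b, b, b]) \<subseteq> circle_stabilizer (vector [b, b, b])"
    by (auto simp: point_stabilizer_def circle_stabilizer_def intro: exI[of _ 1])
qed

text \<open>The fixed space of every nonidentity element lies in one of the six hyperplanes
  \<open>x $ i = \<plusminus> x $ j\<close>, the mirrors of the conjugates of
  \<open>mkappa\<close>.\<close>

lemma point_stabilizer_generic:
  assumes "x $ 1 \<noteq> x $ 2" "x $ 1 \<noteq> - x $ 2" "x $ 1 \<noteq> x $ 3" "x $ 1 \<noteq> - x $ 3"
    "x $ 2 \<noteq> x $ 3" "x $ 2 \<noteq> - x $ 3"
  shows "point_stabilizer x = {mat 1}"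
proof -
  have "g = mat 1" if "g \<in> tetra" "g *v x = x" for g
    using that assms
    by (cases rule: tetra_cases) (auto simp: sp_apply vector_3_eq_iff mat_1_sp)
  then show ?thesis by (auto simp: point_stabilizer_def one_in_tetra)
qed

text \<open>The excluded vectors of the plane fixed by \<open>mkappa\<close> have a larger
  stabilizer: they lie on the first coordinate axis (\<open>a = 0\<close>) or on an axis of a
  threefold rotation (\<open>b = a\<close> or \<open>b = - a\<close>).\<close>

lemma point_stabilizer_plane:
  assumes "a \<noteq> 0" "b \<noteq> a" "b \<noteq> - a"
  shows "point_stabilizer (vector [b, a, a]) = Z2_kappa"
proof
  show "point_stabilizer (vector [b, a, a]) \<subseteq> Z2_kappa"
  proof
    fix g assume "g \<in> point_stabilizer (vector [b, a, a])"
    then have "g \<in> tetra" "g *v vector [b, a, a] = vector [b, a, a]"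
      by (auto simp: point_stabilizer_def)
    then show "g \<in> Z2_kappa"
      using assms by (cases rule: tetra_cases) (auto simp: sp_apply vector_3_eq_iff Z2_kappa_eq)
  qed
qed (auto simp: Z2_kappa_eq point_stabilizer_def sp_apply intro!: tetraI)

text \<open>Serves \<open>H = K = Z2_kappa\<close>. The moduli keep the first coordinate in place;
  the three signs then agree with the phase, and their product 1 makes it 1.\<close>

lemma circle_stabilizer_122: "circle_stabilizer (vector [1, 2, 2]) = Z2_kappa"
proof
  show "circle_stabilizer (vector [1, 2, 2]) \<subseteq> Z2_kappa"
  proof
    fix g assume "g \<in> circle_stabilizer (vector [1, 2, 2])"
    then obtain c where "g \<in> tetra" "g *v vector [1, 2, 2] = c *s vector [1, 2, 2]"
      by (auto simp: circle_stabilizer_def)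
    then show "g \<in> Z2_kappa"
      by (cases rule: tetra_cases) (auto simp: Z2_kappa_eq sp_apply vector_3_eq_iff)
  qed
qed (auto simp: Z2_kappa_eq circle_stabilizer_def sp_apply intro!: tetraI exI[of _ 1])

text \<open>\<open>mR\<close> and its product with \<open>mkappa\<close> act on this vector as -1,
  so they enter only the circle stabilizer.\<close>

lemma stabilizers_011:
  "circle_stabilizer (vector [0, 1, 1]) = D2" "point_stabilizer (vector [0, 1, 1]) = Z2_kappa"
proof -
  show "circle_stabilizer (vector [0, 1, 1]) = D2"
  proof
    show "circle_stabilizer (vector [0, 1, 1]) \<subseteq> D2"
    proof
      fix g assume "g \<in> circle_stabilizer (vector [0, 1, 1])"
      then obtain c where "g \<in> tetra" "g *v vector [0, 1, 1] = c *s vector [0, 1, 1]"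
        by (auto simp: circle_stabilizer_def)
      then show "g \<in> D2"
        by (cases rule: tetra_cases) (auto simp: D2_eq sp_apply vector_3_eq_iff)
    qed
    have "\<exists>c. norm c = 1 \<and> g *v vector [0, 1, 1] = c *s vector [0, 1, 1]" if "g \<in> D2" for g
    proof -
      have "g *v vector [0, 1, 1] = 1 *s vector [0, 1, 1] \<or> g *v vector [0, 1, 1] = (-1) *s vector [0, 1, 1]"
        using that by (auto simp: D2_eq sp_apply vector_3_eq_iff)
      then show ?thesis by (metis norm_minus_cancel norm_one)
    qed
    moreover have "D2 \<subseteq> tetra" by (auto simp: D2_eq intro!: tetraI)
    ultimately show "D2 \<subseteq> circle_stabilizer (vector [0, 1, 1])"
      unfolding circle_stabilizer_def by blast
  qed
  show "point_stabilizer (vector [0, 1, 1]) = Z2_kappa" by (rule point_stabilizer_plane) auto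
qed

text \<open>The distinct moduli exclude every nontrivial permutation of the coordinates; among the
  sign matrices only \<open>mR\<close> acts as a nontrivial phase, namely -1.\<close>

lemma stabilizers_012:
  "circle_stabilizer (vector [0, 1, 2]) = generate Tetra {mR}"
  "point_stabilizer (vector [0, 1, 2]) = {mat 1}"
proof -
  show "circle_stabilizer (vector [0, 1, 2]) = generate Tetra {mR}"
  proof
    show "circle_stabilizer (vector [0, 1, 2]) \<subseteq> generate Tetra {mR}"
    proof
      fix g assume "g \<in> circle_stabilizer (vector [0, 1, 2])"
      then obtain c where "g \<in> tetra" "g *v vector [0, 1, 2] = c *s vector [0, 1, 2]"
        by (auto simp: circle_stabilizer_def)
      then show "g \<in> generate Tetra {mR}"
        by (cases rule: tetra_cases) (auto simp: generate_mR sp_apply vector_3_eq_iff)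
    qed
    have "\<exists>c. norm c = 1 \<and> g *v vector [0, 1, 2] = c *s vector [0, 1, 2]" if "g \<in> generate Tetra {mR}" for g
    proof -
      have "g *v vector [0, 1, 2] = 1 *s vector [0, 1, 2] \<or> g *v vector [0, 1, 2] = (-1) *s vector [0, 1, 2]"
        using that by (auto simp: generate_mR sp_apply vector_3_eq_iff)
      then show ?thesis by (metis norm_minus_cancel norm_one)
    qed
    moreover have "generate Tetra {mR} \<subseteq> tetra" by (auto simp: generate_mR intro!: tetraI)
    ultimately show "generate Tetra {mR} \<subseteq> circle_stabilizer (vector [0, 1, 2])"
      unfolding circle_stabilizer_def by blast
  qed
  show "point_stabilizer (vector [0, 1, 2]) = {mat 1}"
    by (rule point_stabilizer_generic) auto
qed

lemma stabilizers_3cycle: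
  assumes "g = sp 1 2 1 3 1 1 \<or> g = sp 1 3 1 1 1 2"
  obtains v where "v \<noteq> 0" "circle_stabilizer v = generate Tetra {g}" "point_stabilizer v = {mat 1}"
proof -
  \<comment> \<open>\<open>s\<close> is half the square root of 3, so \<open>w\<close> and
    \<open>w'\<close> are the primitive cube roots of unity.\<close>
  define s where "s = sqrt (3 / 4)"
  have s: "s * s = 3 / 4" "s > 0" by (simp_all add: s_def)
  define w where "w = Complex (-1/2) s"
  define w' where "w' = Complex (-1/2) (- s)"
  define v :: "complex^3" where "v = vector [1, w, w']"
  have ww: "w * w = w'" "w * w' = 1" "w' * w' = w" "norm w = 1" "norm w' = 1" "w' * w = 1"
    using s by (simp_all add: w_def w'_def complex_eq_iff cmod_def power2_eq_square)
  have neq: "w \<noteq> 1" "w \<noteq> -1" "w' \<noteq> 1" "w' \<noteq> -1" "w \<noteq> w'" "w \<noteq> - w'" "w \<noteq> 0" "w' \<noteq> 0"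
    "1 \<noteq> w" "1 \<noteq> - w" "1 \<noteq> w'" "1 \<noteq> - w'" "w' \<noteq> w" "w' \<noteq> - w" "- w' \<noteq> w" "- w \<noteq> w'"
    "- w \<noteq> 1" "- w' \<noteq> 1"
    using s by (auto simp: w_def w'_def complex_eq_iff)
  have "circle_stabilizer v = {sp 1 1 1 2 1 3, sp 1 2 1 3 1 1, sp 1 3 1 1 1 2}"
  proof
    show "circle_stabilizer v \<subseteq> {sp 1 1 1 2 1 3, sp 1 2 1 3 1 1, sp 1 3 1 1 1 2}"
    proof
      fix g assume "g \<in> circle_stabilizer v"
      then obtain c where "g \<in> tetra" "g *v v = c *s v" by (auto simp: circle_stabilizer_def)
      then show "g \<in> {sp 1 1 1 2 1 3, sp 1 2 1 3 1 1, sp 1 3 1 1 1 2}"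
        using neq by (cases rule: tetra_cases) (auto simp: v_def sp_apply vector_3_eq_iff ww)
    qed
    have "sp 1 2 1 3 1 1 *v v = w *s v" "sp 1 3 1 1 1 2 *v v = w' *s v" "sp 1 1 1 2 1 3 *v v = 1 *s v"
      by (simp_all add: v_def sp_apply vector_3_eq_iff ww)
    moreover have "norm (1 :: complex) = 1" by simp
    moreover have "{sp 1 1 1 2 1 3, sp 1 2 1 3 1 1, sp 1 3 1 1 1 2} \<subseteq> tetra"
      by (auto intro!: tetraI)
    ultimately show "{sp 1 1 1 2 1 3, sp 1 2 1 3 1 1, sp 1 3 1 1 1 2} \<subseteq> circle_stabilizer v"
      using ww(4,5) unfolding circle_stabilizer_def insert_subset by blast
  qed
  moreover have "point_stabilizer v = {mat 1}"
    by (rule point_stabilizer_generic) (use neq in \<open>auto simp: v_def\<close>)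
  moreover have "v \<noteq> 0" by (simp add: v_def vector_3_eq_iff)
  ultimately show thesis using that generate_3cycle[OF assms] by simp
qed

text \<open>On this vector the elements of order 4 act as multiplication by \<open>\<i>\<close> or
  \<open>- \<i>\<close>, and their square \<open>mR\<close> acts as -1.\<close>

lemma stabilizers_4cycle:
  assumes "g = sp (-1) 1 (-1) 3 1 2 \<or> g = sp (-1) 1 1 3 (-1) 2"
  shows "circle_stabilizer (vector [0, 1, \<i>]) = generate Tetra {g}"
    "point_stabilizer (vector [0, 1, \<i>]) = {mat 1}"
proof -
  let ?v = "vector [0, 1, \<i>] :: complex^3"
  let ?E = "{sp 1 1 1 2 1 3, sp 1 1 (-1) 2 (-1) 3, sp (-1) 1 (-1) 3 1 2, sp (-1) 1 1 3 (-1) 2}"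
  have "circle_stabilizer ?v = ?E"
  proof
    show "circle_stabilizer ?v \<subseteq> ?E"
    proof
      fix g assume "g \<in> circle_stabilizer ?v"
      then obtain c where "g \<in> tetra" "g *v ?v = c *s ?v" by (auto simp: circle_stabilizer_def)
      then show "g \<in> ?E"
        by (cases rule: tetra_cases) (auto simp: sp_apply vector_3_eq_iff)
    qed
    have "sp 1 1 1 2 1 3 *v ?v = 1 *s ?v" "sp 1 1 (-1) 2 (-1) 3 *v ?v = (-1) *s ?v"
        "sp (-1) 1 (-1) 3 1 2 *v ?v = (- \<i>) *s ?v" "sp (-1) 1 1 3 (-1) 2 *v ?v = \<i> *s ?v"
      by (simp_all add: sp_apply vector_3_eq_iff)
    moreover have "?E \<subseteq> tetra" by (auto intro!: tetraI)
    moreover have "norm (1 :: complex) = 1" "norm (-1 :: complex) = 1" "norm (- \<i>) = 1" "norm \<i> = 1"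
      by simp_all
    ultimately show "?E \<subseteq> circle_stabilizer ?v"
      unfolding circle_stabilizer_def insert_subset by blast
  qed
  then show "circle_stabilizer ?v = generate Tetra {g}" using generate_4cycle[OF assms] by simp
  show "point_stabilizer ?v = {mat 1}"
    by (rule point_stabilizer_generic) (auto simp: complex_eq_iff)
qed

section \<open>Classification of the admissible pairs\<close>

text \<open>Normality of \<open>K\<close> in \<open>H\<close> is put as an equation between
  products, a form that conjugation carries along.\<close>

definition conditions_core :: "(complex^3^3) set \<Rightarrow> (complex^3^3) set \<Rightarrow> bool" where
  "conditions_core H K \<longleftrightarrow> subgroup H Tetra \<and> K \<subseteq> H \<and> (\<forall>h\<in>H. \<forall>k\<in>K. \<exists>k'\<in>K. k ** h = h ** k')"

lemma conditions_core_conj: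
  assumes g: "g \<in> tetra" and "conditions_core H K"
  shows "conditions_core (conj_set g H) (conj_set g K)"
  unfolding conditions_core_def
proof (intro conjI ballI)
  note H = assms(2)[unfolded conditions_core_def]
  show "subgroup (conj_set g H) Tetra" using H subgroup_conj[OF g] by blast
  show "conj_set g K \<subseteq> conj_set g H" using H by (auto simp: conj_set_def)
  have conj: "(g ** a ** tinv g) ** (g ** b ** tinv g) = g ** (a ** b) ** tinv g" for a b
  proof -
    have "(g ** a ** tinv g) ** (g ** b ** tinv g) = g ** a ** (tinv g ** g) ** b ** tinv g"
      by (simp only: matrix_mul_assoc)
    then show ?thesis using g by (simp add: matrix_mul_assoc)
  qed
  fix h' k' assume "h' \<in> conj_set g H" "k' \<in> conj_set g K"
  then obtain h k where hk: "h \<in> H" "h' = g ** h ** tinv g" "k \<in> K" "k' = g ** k ** tinv g"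
    by (auto simp: conj_set_def)
  then obtain k'' where "k'' \<in> K" "k ** h = h ** k''" using H by blast
  then show "\<exists>l\<in>conj_set g K. k' ** h' = h' ** l"
    unfolding hk by (intro bexI[of _ "g ** k'' ** tinv g"]) (simp_all add: conj conj_set_def)
qed

text \<open>\<open>H\<close> normalizes the point stabilizer, hence preserves its fixed-point
  space.\<close>

lemma conditions_core_fixes:
  assumes "conditions_core H (point_stabilizer y)" "h \<in> H" "k \<in> point_stabilizer y"
  shows "k *v (h *v y) = h *v y"
proof -
  obtain k' where "k' \<in> point_stabilizer y" "k ** h = h ** k'"
    using assms unfolding conditions_core_def by blast
  then have "k *v (h *v y) = h *v (k' *v y)" by (simp add: matrix_vector_mul_assoc)
  then show ?thesis using \<open>k' \<in> point_stabilizer y\<close> by (simp add: point_stabilizer_def)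
qed

lemma conditions_core_mem:
  assumes "conditions_core H K" "h \<in> H" "h ** g \<in> H" "g \<in> tetra"
  shows "g \<in> H"
proof -
  have H: "subgroup H Tetra" using assms(1) by (simp add: conditions_core_def)
  then have "h \<in> tetra" using assms(2) subgroup.subset by fastforce
  have "tinv h ** (h ** g) \<in> H"
    using subgroup.m_closed[OF H subgroup.m_inv_closed[OF H assms(2)] assms(3)] by simp
  then show ?thesis using \<open>h \<in> tetra\<close> by (simp add: matrix_mul_assoc)
qed

text \<open>\<open>H\<close> preserves the axis fixed by \<open>mR\<close> and acts on it by signs.
  If all signs are 1, then \<open>H = K\<close>, which is the exceptional pair; otherwise
  \<open>K\<close> and one element acting as -1 produce all elements that act as -1.\<close>

lemma classify_axis:
  assumes "b \<noteq> 0" and y: "y = vector [b, 0, 0]" and core: "conditions_core H (point_stabilizer y)"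
  shows "H = D2 \<and> point_stabilizer y = D2 \<or> H = circle_stabilizer y"
proof -
  have K: "point_stabilizer y = D2" unfolding y by (rule point_stabilizer_axis[OF assms(1)])
  have sub: "H \<subseteq> tetra" and KH: "point_stabilizer y \<subseteq> H"
    using core subgroup.subset by (fastforce simp: conditions_core_def)+
  have circle: "g *v y = y \<or> g *v y = - y" if "g \<in> tetra" "g *v y = c *s y" for g c
    using that assms(1) unfolding y
    by (cases rule: tetra_cases) (auto simp: sp_apply vector_3_eq_iff)
  have R: "mR \<in> point_stabilizer y" unfolding K by (simp add: D2_eq generators_sp)
  have H: "h *v y = y \<or> h *v y = - y" if "h \<in> H" for h
  proof -
    have "mR *v (h *v y) = h *v y" by (rule conditions_core_fixes[OF core that R])
    moreover have "h \<in> tetra" using that sub by blast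
    ultimately show ?thesis
      using assms(1) unfolding y
      by (cases rule: tetra_cases[OF \<open>h \<in> tetra\<close>]) (auto simp: generators_sp sp_apply vector_3_eq_iff)
  qed
  show ?thesis
  proof (cases "\<forall>h\<in>H. h *v y = y")
    case True
    then have "H \<subseteq> point_stabilizer y" using sub by (auto simp: point_stabilizer_def)
    then show ?thesis using KH K by blast
  next
    case False
    then obtain h where h: "h \<in> H" "h *v y = - y" using H by blast
    have "H \<subseteq> circle_stabilizer y"
    proof
      fix g assume "g \<in> H"
      then have "g *v y = 1 *s y \<or> g *v y = (-1) *s y" using H by (simp add: vec_eq_iff)
      then show "g \<in> circle_stabilizer y"
        using \<open>g \<in> H\<close> sub by (auto simp: circle_stabilizer_def intro: exI[of _ 1] exI[of _ "-1"])
    qed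
    moreover have "circle_stabilizer y \<subseteq> H"
    proof
      fix g assume g: "g \<in> circle_stabilizer y"
      then have "g \<in> tetra" by (simp add: circle_stabilizer_def)
      from g consider "g *v y = y" | "g *v y = - y"
        using circle unfolding circle_stabilizer_def by blast
      then show "g \<in> H"
      proof cases
        case 1
        then show ?thesis using KH \<open>g \<in> tetra\<close> by (auto simp: point_stabilizer_def)
      next
        case 2
        have "h *v (- y) = - (h *v y)" by (metis linear_matrix_vector_mult linear_neg)
        then have "h ** g \<in> point_stabilizer y"
          using 2 h sub tetra_mult \<open>g \<in> tetra\<close>
          by (auto simp: point_stabilizer_def matrix_vector_mul_assoc[symmetric])
        then show ?thesis using conditions_core_mem[OF core h(1)] KH \<open>g \<in> tetra\<close> by blast
      qed
    qed
    ultimately show ?thesis by blast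
  qed
qed

text \<open>A vector \<open>h *v y\<close> fixed by \<open>mC\<close> and \<open>mkappa\<close> is
  diagonal, and three equal signs with product 1 leave only \<open>y\<close>. So \<open>H\<close> is
  no larger than the point stabilizer.\<close>

lemma classify_diagonal:
  assumes "b \<noteq> 0" and y: "y = vector [b, b, b]" and core: "conditions_core H (point_stabilizer y)"
  shows "H = circle_stabilizer y"
proof -
  have sub: "H \<subseteq> tetra" and KH: "point_stabilizer y \<subseteq> H"
    using core subgroup.subset by (fastforce simp: conditions_core_def)+
  have K: "mC \<in> point_stabilizer y" "mkappa \<in> point_stabilizer y"
    by (auto simp: y point_stabilizer_def generators_sp sp_apply intro!: tetraI)
  have "H \<subseteq> point_stabilizer y"
  proof
    fix h assume h: "h \<in> H"
    have "mC *v (h *v y) = h *v y" "mkappa *v (h *v y) = h *v y"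
      using conditions_core_fixes[OF core h] K by blast+
    moreover have "h \<in> tetra" using h sub by blast
    ultimately have "h *v y = y"
      using assms(1) unfolding y
      by (cases rule: tetra_cases[OF \<open>h \<in> tetra\<close>]) (auto simp: generators_sp sp_apply vector_3_eq_iff)
    then show "h \<in> point_stabilizer y" using \<open>h \<in> tetra\<close> by (simp add: point_stabilizer_def)
  qed
  then show ?thesis using KH circle_stabilizer_diagonal[OF assms(1)] unfolding y by blast
qed

text \<open>\<open>H\<close> normalizes \<open>Z2_kappa\<close>, hence lies in \<open>D2\<close>,
  where \<open>Z2_kappa\<close> has index 2; so \<open>H\<close> is one of these two groups. The
  vector \<open>v\<close> may differ from \<open>y\<close>, since only the stabilizers
  matter.\<close>

lemma classify_plane:
  assumes "a \<noteq> 0" "b \<noteq> a" "b \<noteq> - a" and y: "y = vector [b, a, a]"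
    and core: "conditions_core H (point_stabilizer y)"
  obtains v where "v \<noteq> 0" "H = circle_stabilizer v" "point_stabilizer y = point_stabilizer v"
proof -
  have K: "point_stabilizer y = Z2_kappa" unfolding y by (rule point_stabilizer_plane[OF assms(1-3)])
  have H: "subgroup H Tetra" and sub: "H \<subseteq> tetra" and KH: "Z2_kappa \<subseteq> H"
    using core subgroup.subset unfolding K by (fastforce simp: conditions_core_def)+
  have HD: "H \<subseteq> D2"
  proof
    fix h assume h: "h \<in> H"
    have kap: "mkappa \<in> Z2_kappa" by (simp add: Z2_kappa_eq generators_sp)
    obtain k where "k \<in> Z2_kappa" "mkappa ** h = h ** k"
      using core h kap unfolding conditions_core_def K by blast
    moreover have "h \<in> tetra" using h sub by blast
    ultimately show "h \<in> D2"
      by (cases rule: tetra_cases[OF \<open>h \<in> tetra\<close>])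
        (auto simp: D2_eq Z2_kappa_eq generators_sp sp_mult sp_eq_iff)
  qed
  show thesis
  proof (cases "H \<subseteq> Z2_kappa")
    case True
    have "(vector [1, 2, 2] :: complex^3) \<noteq> 0" by (simp add: vector_3_eq_iff)
    moreover have "point_stabilizer (vector [1, 2, 2]) = Z2_kappa"
      by (rule point_stabilizer_plane) auto
    ultimately show thesis
      using that[of "vector [1, 2, 2]"] True KH K circle_stabilizer_122 by simp
  next
    case False
    then obtain h where h: "h \<in> H" "h \<in> D2" "h \<notin> Z2_kappa" using HD by blast
    have "D2 \<subseteq> H"
    proof
      fix g assume g: "g \<in> D2"
      then have "g \<in> tetra" by (auto simp: D2_eq intro!: tetraI)
      \<comment> \<open>Index 2: two elements of \<open>D2\<close> outside \<open>Z2_kappa\<close>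
        have their product inside.\<close>
      have "g \<in> Z2_kappa \<or> h ** g \<in> Z2_kappa"
        using g h(2,3) by (auto simp: D2_eq Z2_kappa_eq sp_mult)
      then show "g \<in> H" using KH conditions_core_mem[OF core h(1)] \<open>g \<in> tetra\<close> by blast
    qed
    moreover have "(vector [0, 1, 1] :: complex^3) \<noteq> 0" by (simp add: vector_3_eq_iff)
    ultimately show thesis
      using that[of "vector [0, 1, 1]"] HD K stabilizers_011 by simp
  qed
qed

text \<open>One of the six equations in \<open>point_stabilizer_generic\<close> must hold, and a
  suitable group element turns it into equality of the second and third coordinates.\<close>

lemma nonregular_orbit:
  assumes "point_stabilizer x \<noteq> {mat 1}"
  obtains g a b where "g \<in> tetra" "g *v x = vector [b, a, a]"
proof -
  have ex: thesis if "sp p a q b r c *v x = vector [b', a', a']" "sp p a q b r c \<in> tetra" for p a q b r c b' a'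
    using \<open>\<And>g b a. g \<in> tetra \<Longrightarrow> g *v x = vector [b, a, a] \<Longrightarrow> thesis\<close> that by blast
  consider "x $ 1 = x $ 2" | "x $ 1 = - x $ 2" | "x $ 1 = x $ 3" | "x $ 1 = - x $ 3"
    | "x $ 2 = x $ 3" | "x $ 2 = - x $ 3"
    using point_stabilizer_generic[of x] assms by blast
  then show thesis
  proof cases
    case 1
    show thesis
      by (rule ex[of 1 3 1 1 1 2 "x $ 3" "x $ 2"]) (auto simp: sp_apply vector_3_eq_iff 1 intro!: tetraI)
  next
    case 2
    show thesis
      by (rule ex[of "-1" 3 1 1 "-1" 2 "- x $ 3" "- x $ 2"]) (auto simp: sp_apply vector_3_eq_iff 2 intro!: tetraI)
  next
    case 3
    show thesis
      by (rule ex[of 1 2 1 1 1 3 "x $ 2" "x $ 3"]) (auto simp: sp_apply vector_3_eq_iff 3 intro!: tetraI)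
  next
    case 4
    show thesis
      by (rule ex[of "-1" 2 1 1 "-1" 3 "- x $ 2" "- x $ 3"]) (auto simp: sp_apply vector_3_eq_iff 4 intro!: tetraI)
  next
    case 5
    show thesis
      by (rule ex[of 1 1 1 2 1 3 "x $ 1" "x $ 3"]) (auto simp: sp_apply vector_3_eq_iff 5 intro!: tetraI)
  next
    case 6
    show thesis
      by (rule ex[of "-1" 1 1 2 "-1" 3 "- x $ 1" "- x $ 3"]) (auto simp: sp_apply vector_3_eq_iff 6 intro!: tetraI)
  qed
qed

text \<open>The conjugators come from a computer search for a smallest list that works; the six conjugates
  of \<open>\<kappa>\<close> show that fewer cannot do.\<close>

lemma conjugate_representative:
  assumes "h \<in> tetra"
  obtains g h0 where "g \<in> tetra" "g ** h = h0 ** g"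
    "h0 = mat 1 \<or> h0 = mkappa \<or> h0 = mR \<or> h0 = sp 1 2 1 3 1 1 \<or> h0 = sp 1 3 1 1 1 2 \<or>
     h0 = sp (-1) 1 (-1) 3 1 2 \<or> h0 = sp (-1) 1 1 3 (-1) 2"
proof -
  have "\<exists>g\<in>{sp 1 1 1 2 1 3, sp (-1) 1 1 2 (-1) 3, sp 1 2 1 1 1 3, sp (-1) 2 1 1 (-1) 3,
        sp 1 3 (-1) 1 (-1) 2, sp (-1) 3 1 1 (-1) 2}.
      \<exists>h0\<in>{sp 1 1 1 2 1 3, sp 1 1 1 3 1 2, sp 1 1 (-1) 2 (-1) 3, sp 1 2 1 3 1 1, sp 1 3 1 1 1 2,
        sp (-1) 1 (-1) 3 1 2, sp (-1) 1 1 3 (-1) 2}. g ** h = h0 ** g"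
    using assms by (cases rule: tetra_cases) (auto simp: sp_mult sp_eq_iff)
  then obtain g h0 where g: "g \<in> {sp 1 1 1 2 1 3, sp (-1) 1 1 2 (-1) 3, sp 1 2 1 1 1 3, sp (-1) 2 1 1 (-1) 3,
        sp 1 3 (-1) 1 (-1) 2, sp (-1) 3 1 1 (-1) 2}"
    and h0: "h0 \<in> {sp 1 1 1 2 1 3, sp 1 1 1 3 1 2, sp 1 1 (-1) 2 (-1) 3, sp 1 2 1 3 1 1, sp 1 3 1 1 1 2,
        sp (-1) 1 (-1) 3 1 2, sp (-1) 1 1 3 (-1) 2}" and eq: "g ** h = h0 ** g"
    by blast
  show thesis
  proof (rule that[of g h0])
    show "g \<in> tetra" using g by (auto intro!: tetraI)
  qed (use h0 eq in \<open>auto simp: mat_1_sp generators_sp\<close>)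
qed

definition exceptional :: "(complex^3^3) set \<Rightarrow> (complex^3^3) set \<Rightarrow> bool" where
  "exceptional H K \<longleftrightarrow> H = D2 \<and> K = D2 \<or> H = Z2_kappa \<and> K = {mat 1}"

text \<open>The case of trivial \<open>K\<close>: conjugation brings the generator into a short
  list, where each nontrivial entry other than \<open>mkappa\<close> has a test vector.\<close>

lemma classify_cyclic:
  assumes "h \<in> tetra" "generate Tetra {h} \<noteq> {mat 1}"
  shows "\<exists>g\<in>tetra. exceptional (conj_set g (generate Tetra {h})) (conj_set g {mat 1}) \<or>
    (\<exists>v. v \<noteq> 0 \<and> conj_set g (generate Tetra {h}) = circle_stabilizer v \<and>
      conj_set g {mat 1} = point_stabilizer v)"
proof -
  obtain g h0 where g: "g \<in> tetra" "g ** h = h0 ** g" and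
    h0: "h0 = mat 1 \<or> h0 = mkappa \<or> h0 = mR \<or> h0 = sp 1 2 1 3 1 1 \<or> h0 = sp 1 3 1 1 1 2 \<or>
     h0 = sp (-1) 1 (-1) 3 1 2 \<or> h0 = sp (-1) 1 1 3 (-1) 2"
    using conjugate_representative[OF assms(1)] by blast
  have "g ** h ** tinv g = h0 ** (g ** tinv g)" using g by (simp only: matrix_mul_assoc)
  then have gen: "conj_set g (generate Tetra {h}) = generate Tetra {h0}"
    using generate_conj[OF g(1) assms(1)] g(1) by simp
  have one: "conj_set g {mat 1} = {mat 1}" using g(1) by (simp add: conj_set_def)
  have ne: "h0 \<noteq> mat 1"
  proof
    assume "h0 = mat 1"
    then have "g ** h = g" using g by simp
    then have "h = mat 1" using g(1) by (metis matrix_mul_assoc matrix_mul_lid tinv(2))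
    then have "generate Tetra {h} = {mat 1}" using T.generate_one by simp
    then show False using assms(2) by contradiction
  qed
  from h0 ne consider "h0 = mkappa" | "h0 = mR" | "h0 = sp 1 2 1 3 1 1 \<or> h0 = sp 1 3 1 1 1 2"
    | "h0 = sp (-1) 1 (-1) 3 1 2 \<or> h0 = sp (-1) 1 1 3 (-1) 2" by blast
  then have "exceptional (generate Tetra {h0}) {mat 1} \<or>
    (\<exists>v. v \<noteq> 0 \<and> generate Tetra {h0} = circle_stabilizer v \<and> {mat 1} = point_stabilizer v)"
  proof cases
    case 1
    then show ?thesis by (simp add: exceptional_def Z2_kappa_def)
  next
    case 2
    have "(vector [0, 1, 2] :: complex^3) \<noteq> 0" by (simp add: vector_3_eq_iff)
    then show ?thesis using 2 stabilizers_012 by metis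
  next
    case 3
    then show ?thesis using stabilizers_3cycle by metis
  next
    case 4
    have "(vector [0, 1, \<i>] :: complex^3) \<noteq> 0" by (simp add: vector_3_eq_iff)
    then show ?thesis using 4 stabilizers_4cycle by metis
  qed
  then show ?thesis using g(1) gen one by metis
qed

text \<open>After \<open>x\<close> is moved into the plane fixed by \<open>mkappa\<close>, the
  coordinate axis, the diagonal and the rest of the plane are treated separately.\<close>

lemma classify_nonregular:
  assumes "x \<noteq> 0" "point_stabilizer x \<noteq> {mat 1}" "conditions_core H (point_stabilizer x)"
  shows "\<exists>g\<in>tetra. exceptional (conj_set g H) (conj_set g (point_stabilizer x)) \<or>
    (\<exists>v. v \<noteq> 0 \<and> conj_set g H = circle_stabilizer v \<and>
      conj_set g (point_stabilizer x) = point_stabilizer v)"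
proof -
  have main: ?thesis if g: "g \<in> tetra" and y: "g *v x = vector [b, a, a]" and nb: "b \<noteq> - a \<or> a = 0" for g a b
  proof -
    let ?y = "vector [b, a, a] :: complex^3"
    have K: "conj_set g (point_stabilizer x) = point_stabilizer ?y"
      using point_stabilizer_image[OF g, of x] y by simp
    have core: "conditions_core (conj_set g H) (point_stabilizer ?y)"
      using conditions_core_conj[OF g assms(3)] K by simp
    have "?y \<noteq> 0"
    proof
      assume "?y = 0"
      then have "x = 0" using y g tinv_apply(1)[OF g, of x] by simp
      then show False using assms(1) by contradiction
    qed
    then have "b \<noteq> 0 \<or> a \<noteq> 0" by (auto simp: vector_3_eq_iff)
    then consider "a = 0" "b \<noteq> 0" | "a \<noteq> 0" "b = a" | "a \<noteq> 0" "b \<noteq> a" "b \<noteq> - a"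
      using nb by blast
    then have "exceptional (conj_set g H) (point_stabilizer ?y) \<or>
      (\<exists>v. v \<noteq> 0 \<and> conj_set g H = circle_stabilizer v \<and> point_stabilizer ?y = point_stabilizer v)"
    proof cases
      case 1
      then show ?thesis
        using classify_axis[of b ?y "conj_set g H"] core \<open>?y \<noteq> 0\<close> unfolding exceptional_def by auto
    next
      case 2
      then show ?thesis
        using classify_diagonal[of b ?y "conj_set g H"] core \<open>?y \<noteq> 0\<close> by auto
    next
      case 3
      from classify_plane[OF this refl core] show ?thesis by metis
    qed
    then show ?thesis using g K by (intro bexI[of _ g]) simp_all
  qed
  obtain g a b where g: "g \<in> tetra" "g *v x = vector [b, a, a]"
    using nonregular_orbit[OF assms(2)] by blast
  show ?thesis
  proof (cases "b \<noteq> - a \<or> a = 0")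
    case True
    then show ?thesis by (rule main[OF g])
  next
    case False
    \<comment> \<open>The remaining threefold axis of the plane, \<open>b = - a\<close>, is carried
      to the diagonal by \<open>mR\<close>.\<close>
    then have "(mR ** g) *v x = vector [b, b, b]"
      using g(2) by (simp add: generators_sp sp_apply flip: matrix_vector_mul_assoc)
    then show ?thesis
      using main[of "mR ** g" b b] tetra_mult[OF generators_tetra(1) g(1)] False by auto
  qed
qed

section \<open>Occurrence at a primary Hopf bifurcation\<close>

lemma Hopf_family_radial: "Hopf_family Tetra radial_family"
proof -
  have "equivariant_family Tetra radial_family"
    by (auto simp: equivariant_family_def radial_family_def tetra_inner matrix_vector_right_distrib
        matrix_vector_mult_scalar matrix_vector_mult_real_scalar)
  moreover have
    "alg_multiplicity (Complex \<mu> 1) (frechet_derivative (\<lambda>x. radial_family (x, \<mu>)) (at 0)) = 3"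
    "alg_multiplicity (Complex \<mu> (- 1)) (frechet_derivative (\<lambda>x. radial_family (x, \<mu>)) (at 0)) = 3"
    for \<mu>
    unfolding radial_family_derivative
    by (subst alg_multiplicity_scalar_mult; simp add: complex_eq_iff)+
  \<comment> \<open>The witnesses are \<open>\<sigma> \<mu> = \<mu>\<close>,
    \<open>\<rho> \<mu> = 1\<close> and the derivative 1.\<close>
  ultimately show ?thesis
    unfolding Hopf_family_def using smooth_radial_family
    by (intro conjI exI[of "\<lambda>\<sigma>. \<exists>\<rho> \<sigma>'. _ \<sigma> \<rho> \<sigma>'" "\<lambda>\<mu>. \<mu>"] exI[of "\<lambda>\<rho>. \<exists>\<sigma>'. _ \<rho> \<sigma>'" "\<lambda>\<mu>. 1"] exI[of _ "1 :: real"])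
      auto
qed

lemma occurs_stabilizers:
  assumes "v \<noteq> 0"
  shows "occurs_at_primary_Hopf Tetra (circle_stabilizer v) (point_stabilizer v)"
  using rotating_wave_branch[OF assms, of Tetra] Hopf_family_radial
  unfolding occurs_at_primary_Hopf_def circle_stabilizer_def point_stabilizer_def Tetra_simps
  by blast

text \<open>The same family serves: by equivariance \<open>g\<close> maps the branch to a branch, it
  preserves amplitudes as an isometry, and it conjugates both symmetry groups.\<close>

lemma occurs_conj:
  assumes g: "g \<in> tetra" and "occurs_at_primary_Hopf Tetra H K"
  shows "occurs_at_primary_Hopf Tetra (conj_set g H) (conj_set g K)"
proof -
  from assms(2) obtain f \<epsilon> \<Lambda> T x where f: "Hopf_family Tetra f"
    and br: "periodic_branch Tetra f H K \<epsilon> \<Lambda> T x"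
    unfolding occurs_at_primary_Hopf_def by blast
  define y where "y s t = g *v x s t" for s t
  have inj: "g *v u = g *v w \<longleftrightarrow> u = w" for u w using tinv_apply(1)[OF g] by metis
  have mem: "h \<in> tetra \<longleftrightarrow> tinv g ** h ** g \<in> tetra" for h
  proof -
    have "h = g ** (tinv g ** h ** g) ** tinv g"
      using g by (simp add: matrix_mul_assoc) (simp flip: matrix_mul_assoc)
    then show ?thesis using g tetra_mult tinv(1) by metis
  qed
  have act: "(tinv g ** h ** g) *v u = tinv g *v (h *v (g *v u))" for h u
    by (simp add: matrix_vector_mul_assoc matrix_mul_assoc)
  have spatial: "spatial_symmetries Tetra (y s) = conj_set g (spatial_symmetries Tetra (x s))" for s
  proof -
    have "h *v y s t = y s t \<longleftrightarrow> (tinv g ** h ** g) *v x s t = x s t" for h t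
      unfolding act y_def using tinv_apply[OF g] by metis
    then show ?thesis
      unfolding set_eq_iff mem_conj_set[OF g] spatial_symmetries_def mem_Collect_eq Tetra_simps
      using mem by blast
  qed
  have temporal: "spatiotemporal_symmetries Tetra (y s) =
      conj_set g (spatiotemporal_symmetries Tetra (x s))" for s
  proof -
    have range: "range (y s) = (*v) g ` range (x s)" by (simp add: y_def[abs_def] image_image)
    have "(*v) h ` range (y s) = range (y s) \<longleftrightarrow>
        (*v) (tinv g ** h ** g) ` range (x s) = range (x s)" for h
    proof -
      have "(*v) (tinv g ** h ** g) ` range (x s) = (*v) (tinv g) ` ((*v) h ` range (y s))"
        by (simp add: range image_image act)
      moreover have "(*v) (tinv g) ` range (y s) = range (x s)"
        using g by (simp add: range image_image)
      moreover have "inj ((*v) (tinv g))"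
        using tinv_apply(2)[OF g] by (metis injI)
      ultimately show ?thesis by (metis inj_image_eq_iff)
    qed
    then have "h \<in> spatiotemporal_symmetries Tetra (y s) \<longleftrightarrow>
        h \<in> conj_set g (spatiotemporal_symmetries Tetra (x s))" for h
      unfolding mem_conj_set[OF g] spatiotemporal_symmetries_def mem_Collect_eq Tetra_simps
      using mem by blast
    then show ?thesis by (rule Set.set_eqI)
  qed
  have eq: "equivariant_family Tetra f" using f by (simp add: Hopf_family_def)
  have "minimal_period (y s) p \<longleftrightarrow> minimal_period (x s) p" for s p
    by (simp add: minimal_period_def y_def inj)
  moreover have "continuous_on S (\<lambda>z. g *v h z)" if "continuous_on S h"
    for S :: "(real \<times> real) set" and h :: "real \<times> real \<Rightarrow> complex^3"
    by (rule bounded_linear.continuous_on[OF bounded_linear_matrix_vector_mult that])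
  moreover have "uniform_limit UNIV y (\<lambda>t. 0) (at_right 0)" if "uniform_limit UNIV x (\<lambda>t. 0) (at_right 0)"
    using that by (simp add: uniform_limit_iff y_def tetra_norm[OF g])
  ultimately have "periodic_branch Tetra f (conj_set g H) (conj_set g K) \<epsilon> \<Lambda> T y"
    using br solution_of_equivariant[OF eq g]
    unfolding periodic_branch_def by (simp add: spatial temporal split_def) (simp add: y_def[abs_def])
  then show ?thesis using f unfolding occurs_at_primary_Hopf_def by blast
qed

lemma occurs_conj_iff:
  assumes "g \<in> tetra"
  shows "occurs_at_primary_Hopf Tetra (conj_set g H) (conj_set g K) \<longleftrightarrow> occurs_at_primary_Hopf Tetra H K"
  using occurs_conj[OF assms] occurs_conj[OF tinv(1)[OF assms]] conj_set_inverse(2)[OF assms] by metis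

section \<open>The two exceptional pairs do not occur\<close>

lemma D2_not_occurs: "\<not> occurs_at_primary_Hopf Tetra D2 D2"
proof
  assume "occurs_at_primary_Hopf Tetra D2 D2"
  then obtain f \<epsilon> \<Lambda> T x where f: "Hopf_family Tetra f"
    and br: "periodic_branch Tetra f D2 D2 \<epsilon> \<Lambda> T x"
    unfolding occurs_at_primary_Hopf_def by blast
  have eq: "equivariant_family Tetra f" using f by (simp add: Hopf_family_def)
  from Hopf_branch_rigidity[OF f br] obtain s r where s: "s \<in> {0<..<\<epsilon>}" "\<forall>t. norm (x s t) < r" and
    rigid: "\<forall>u w. solution_of (\<lambda>y. f (y, \<Lambda> s)) u \<longrightarrow> solution_of (\<lambda>y. f (y, \<Lambda> s)) w \<longrightarrow>
      (\<forall>t. norm (u t) < r \<and> norm (w t) < r) \<longrightarrow>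
      u 0 = w 0 \<or> (\<forall>t. u (t + T s / 2) - w (t + T s / 2) = u t - w t) \<longrightarrow> u = w"
    by (elim bexE exE conjE)
  have sol: "solution_of (\<lambda>y. f (y, \<Lambda> s)) (x s)" and per: "\<And>t. x s (t + T s) = x s t"
    and H: "spatiotemporal_symmetries Tetra (x s) = D2" and K: "spatial_symmetries Tetra (x s) = D2"
    using br s(1) by (auto simp: periodic_branch_def minimal_period_def)
  \<comment> \<open>\<open>\<rho>\<close> lies outside \<open>D2\<close> and acts as -1 on the first
    coordinate axis, to which the spatial symmetry \<open>mR\<close> confines the solution.\<close>
  define \<rho> where "\<rho> = sp (-1) 1 (-1) 2 1 3"
  have \<rho>: "\<rho> \<in> tetra" "\<rho> \<notin> D2" by (auto simp: \<rho>_def D2_eq sp_eq_iff intro!: tetraI)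
  have x0: "x s t $ 2 = 0" "x s t $ 3 = 0" for t
  proof -
    have "sp 1 1 (-1) 2 (-1) 3 \<in> spatial_symmetries Tetra (x s)" by (simp add: K D2_eq)
    then have "sp 1 1 (-1) 2 (-1) 3 *v x s t = x s t" by (simp add: spatial_symmetries_def)
    then show "x s t $ 2 = 0" "x s t $ 3 = 0" by (auto simp: sp_apply vector_3_eq_iff)
  qed
  have "x s = (\<lambda>t. \<rho> *v x s (t + T s / 2))"
  proof (rule rigid[rule_format, OF sol])
    show "solution_of (\<lambda>y. f (y, \<Lambda> s)) (\<lambda>t. \<rho> *v x s (t + T s / 2))"
      by (intro solution_of_equivariant[OF eq \<rho>(1)] solution_of_shift sol)
    \<comment> \<open>On the axis the difference is \<open>x s t + x s (t + T s / 2)\<close>, which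
      a shift by half a period leaves unchanged.\<close>
    have "x s (t + T s / 2) - \<rho> *v x s (t + T s / 2 + T s / 2) = x s t - \<rho> *v x s (t + T s / 2)" for t
      using per[of t] x0 by (simp add: add.assoc \<rho>_def sp_apply vec_eq_iff forall_3)
    then show "x s 0 = \<rho> *v x s (0 + T s / 2) \<or>
      (\<forall>t. x s (t + T s / 2) - \<rho> *v x s (t + T s / 2 + T s / 2) = x s t - \<rho> *v x s (t + T s / 2))"
      by blast
  qed (use s(2) tetra_norm[OF \<rho>(1)] in auto)
  then have half: "x s t = \<rho> *v x s (t + T s / 2)" for t by (rule fun_cong)
  have "(*v) \<rho> ` range (x s) = range (x s)"
  proof
    show "(*v) \<rho> ` range (x s) \<subseteq> range (x s)"
    proof clarify
      fix t
      have "\<rho> *v x s t = x s (t - T s / 2)" using half[of "t - T s / 2"] by simp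
      then show "\<rho> *v x s t \<in> range (x s)" by simp
    qed
    show "range (x s) \<subseteq> (*v) \<rho> ` range (x s)" using half by blast
  qed
  then have "\<rho> \<in> spatiotemporal_symmetries Tetra (x s)"
    using \<rho>(1) by (simp add: spatiotemporal_symmetries_def)
  then show False using H \<rho>(2) by simp
qed

lemma Z2_kappa_not_occurs: "\<not> occurs_at_primary_Hopf Tetra Z2_kappa {mat 1}"
proof
  assume "occurs_at_primary_Hopf Tetra Z2_kappa {mat 1}"
  then obtain f \<epsilon> \<Lambda> T x where f: "Hopf_family Tetra f"
    and br: "periodic_branch Tetra f Z2_kappa {mat 1} \<epsilon> \<Lambda> T x"
    unfolding occurs_at_primary_Hopf_def by blast
  have eq: "equivariant_family Tetra f" using f by (simp add: Hopf_family_def)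
  from Hopf_branch_rigidity[OF f br] obtain s r where s: "s \<in> {0<..<\<epsilon>}" "\<forall>t. norm (x s t) < r" and
    rigid: "\<forall>u w. solution_of (\<lambda>y. f (y, \<Lambda> s)) u \<longrightarrow> solution_of (\<lambda>y. f (y, \<Lambda> s)) w \<longrightarrow>
      (\<forall>t. norm (u t) < r \<and> norm (w t) < r) \<longrightarrow>
      u 0 = w 0 \<or> (\<forall>t. u (t + T s / 2) - w (t + T s / 2) = u t - w t) \<longrightarrow> u = w"
    by (elim bexE exE conjE)
  have sol: "solution_of (\<lambda>y. f (y, \<Lambda> s)) (x s)" and per: "minimal_period (x s) (T s)"
    and H: "spatiotemporal_symmetries Tetra (x s) = Z2_kappa"
    and K: "spatial_symmetries Tetra (x s) = {mat 1}"
    using br s(1) by (auto simp: periodic_branch_def)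
  have perT: "x s (t + T s) = x s t" for t using per by (simp add: minimal_period_def)
  note kap = generators_tetra(3)
  have noK: False if "g \<in> tetra" "\<And>t. g *v x s t = x s t" "g \<noteq> mat 1" for g
    using that K by (auto simp: spatial_symmetries_def)
  have "mkappa \<in> spatiotemporal_symmetries Tetra (x s)" by (simp add: H Z2_kappa_eq generators_sp)
  then have "mkappa *v x s 0 \<in> range (x s)" by (auto simp: spatiotemporal_symmetries_def)
  then obtain \<tau> where \<tau>: "mkappa *v x s 0 = x s \<tau>" by blast
  \<comment> \<open>\<open>mkappa\<close> sends one point of the trajectory to another; uniqueness
    turns this into a time shift of the whole solution.\<close>
  have "(\<lambda>t. mkappa *v x s t) = (\<lambda>t. x s (t + \<tau>))"
  proof (rule rigid[rule_format])
    show "solution_of (\<lambda>y. f (y, \<Lambda> s)) (\<lambda>t. mkappa *v x s t)"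
      by (rule solution_of_equivariant[OF eq kap sol])
    show "solution_of (\<lambda>y. f (y, \<Lambda> s)) (\<lambda>t. x s (t + \<tau>))" by (rule solution_of_shift[OF sol])
  qed (use s(2) tetra_norm[OF kap] \<tau> in auto)
  then have shift: "mkappa *v x s t = x s (t + \<tau>)" for t by (rule fun_cong)
  \<comment> \<open>\<open>mkappa\<close> is an involution, so twice the shift is a period.\<close>
  have "x s (t + 2 * \<tau>) = x s t" for t
  proof -
    have "x s (t + 2 * \<tau>) = mkappa *v (mkappa *v x s t)" by (simp add: shift add.assoc)
    then show ?thesis by (simp add: generators_sp sp_apply vector_3_eq_iff)
  qed
  then obtain n :: int where n: "2 * \<tau> = of_int n * T s"
    using minimal_period_multiple[OF per] by blast
  \<comment> \<open>For even \<open>n\<close> the shift itself would be a period and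
    \<open>mkappa\<close> a spatial symmetry. Odd \<open>n\<close> makes it half a period.\<close>
  have "odd n"
  proof
    assume "even n"
    then obtain m where "n = 2 * m" by blast
    then have "\<tau> = of_int m * T s" using n by simp
    then have "mkappa *v x s t = x s t" for t
      using period_int_multiple[of "x s" "T s" t m] perT by (simp add: shift)
    then show False by (rule noK[OF kap]) (simp add: generators_sp mat_1_sp sp_eq_iff)
  qed
  then obtain m where "n = 2 * m + 1" by (rule oddE)
  then have "\<tau> = T s / 2 + of_int m * T s" using n by (simp add: algebra_simps)
  then have half: "mkappa *v x s t = x s (t + T s / 2)" for t
    using period_int_multiple[of "x s" "T s" "t + T s / 2" m] perT by (simp add: shift add.assoc)
  \<comment> \<open>This is \<open>mR ** mkappa\<close>.\<close>
  define \<rho> where "\<rho> = sp 1 1 (-1) 3 (-1) 2"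
  have \<rho>: "\<rho> \<in> tetra" by (auto simp: \<rho>_def intro!: tetraI)
  have "x s = (\<lambda>t. \<rho> *v x s t)"
  proof (rule rigid[rule_format, OF sol])
    show "solution_of (\<lambda>y. f (y, \<Lambda> s)) (\<lambda>t. \<rho> *v x s t)"
      by (rule solution_of_equivariant[OF eq \<rho> sol])
    \<comment> \<open>The difference has first coordinate 0 and equal second and third coordinates,
      so it is unchanged by \<open>mkappa\<close>, which is the shift by half a period.\<close>
    have "x s (t + T s / 2) - \<rho> *v x s (t + T s / 2) = x s t - \<rho> *v x s t" for t
      unfolding half[symmetric] by (simp add: \<rho>_def generators_sp sp_apply vec_eq_iff forall_3)
    then show "x s 0 = \<rho> *v x s 0 \<or>
      (\<forall>t. x s (t + T s / 2) - \<rho> *v x s (t + T s / 2) = x s t - \<rho> *v x s t)" by blast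
  qed (use s(2) tetra_norm[OF \<rho>] in auto)
  then have "\<rho> *v x s t = x s t" for t by (metis fun_cong)
  then show False by (rule noK[OF \<rho>]) (simp add: \<rho>_def mat_1_sp sp_eq_iff)
qed

section \<open>The two exceptional pairs satisfy the conditions\<close>

lemma subgroup_D2: "subgroup D2 Tetra"
  unfolding D2_def by (rule T.generate_is_subgroup) (use generators_tetra in auto)

lemma subgroup_Z2_kappa: "subgroup Z2_kappa Tetra"
  unfolding Z2_kappa_def by (rule T.generate_is_subgroup) (use generators_tetra in auto)

lemma cyclic_mod_trivial:
  assumes "subgroup H Tetra"
  shows "cyclic_group (Tetra\<lparr>carrier := H\<rparr> Mod {mat 1}) \<longleftrightarrow> cyclic_group (Tetra\<lparr>carrier := H\<rparr>)"
proof -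
  interpret G: group "Tetra\<lparr>carrier := H\<rparr>" by (rule T.subgroup_imp_group[OF assms])
  have "Tetra\<lparr>carrier := H\<rparr> Mod {mat 1} \<cong> Tetra\<lparr>carrier := H\<rparr>"
    using is_isoI[OF G.trivial_factor_iso] by simp
  moreover have "group (Tetra\<lparr>carrier := H\<rparr> Mod {mat 1})"
    using normal.factorgroup_is_group[OF G.one_is_normal] by simp
  ultimately show ?thesis using isomorphic_group_cyclicity G.group_axioms by blast
qed

lemma independent_Fix_dim:
  assumes "axis i 1 \<in> Fix S" "axis i \<i> \<in> Fix S"
  shows "dim (Fix S) \<ge> 2"
proof -
  have "independent {axis i (1 :: complex), axis i \<i>}"
    by (rule independent_mono[OF independent_Basis]) (auto simp: Basis_complex_def)
  moreover have "card {axis i (1 :: complex), axis i \<i>} = 2"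
    by (simp add: axis_eq_axis complex_eq_iff)
  ultimately show ?thesis
    using independent_card_le_dim[of "{axis i 1, axis i \<i>}" "Fix S"] assms by simp
qed

lemma D2_conditions: "H_mod_K_conditions Tetra D2 D2"
  unfolding H_mod_K_conditions_def
proof (intro conjI impI)
  interpret G: group "Tetra\<lparr>carrier := D2\<rparr>" by (rule T.subgroup_imp_group[OF subgroup_D2])
  show "subgroup D2 Tetra" "subgroup D2 Tetra" by (rule subgroup_D2)+
  show norm: "D2 \<lhd> Tetra\<lparr>carrier := D2\<rparr>" using G.normal_self by simp
  show "cyclic_group (Tetra\<lparr>carrier := D2\<rparr> Mod D2)"
  proof (rule trivial_imp_cyclic_group)
    have "rcosets\<^bsub>Tetra\<lparr>carrier := D2\<rparr>\<^esub> D2 = {D2}"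
      using G.coset_join2[OF _ G.subgroup_self] G.one_closed by (auto simp: RCOSETS_def)
    then show "trivial_group (Tetra\<lparr>carrier := D2\<rparr> Mod D2)"
      using normal.factorgroup_is_group[OF norm]
      by (simp add: trivial_group_def FactGroup_def)
  qed
  let ?e = "vector [1, 0, 0] :: complex^3"
  have K: "point_stabilizer ?e = D2" by (rule point_stabilizer_axis) simp
  then show "isotropy_subgroup D2 Tetra"
    unfolding isotropy_subgroup_def stabilizer_def point_stabilizer_def by auto
  show "2 \<le> dim (Fix D2)"
    by (rule independent_Fix_dim[of 1]) (auto simp: Fix_def D2_eq sp_apply vector_3_eq_iff axis_def)
  show "D2 = D2 \<or> D2 = normalizer Tetra D2" by simp
  \<comment> \<open>\<open>D2\<close> acts trivially on its fixed space, so any component serves;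
    \<open>?e\<close> provides one.\<close>
  have "?e \<in> Fix D2 - L_set Tetra D2"
    using K by (auto simp: Fix_def L_set_def point_stabilizer_def)
  then have "connected_component_set (Fix D2 - L_set Tetra D2) ?e \<in> components (Fix D2 - L_set Tetra D2)"
    by (rule componentsI)
  moreover have "(*v) h ` C = C" if "h \<in> D2" "C \<subseteq> Fix D2" for h C
  proof -
    have "(*v) h ` C = id ` C" using that by (intro image_cong) (auto simp: Fix_def)
    then show ?thesis by simp
  qed
  ultimately show "\<exists>C\<in>components (Fix D2 - L_set Tetra D2). \<forall>h\<in>D2. (*v) h ` C = C"
    by (meson Diff_subset in_components_subset order_trans)
qed simp

lemma Fix_minus_L_trivial: "Fix {mat 1} - L_set Tetra {mat 1} = {x. point_stabilizer x = {mat 1}}"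
proof -
  have "x \<in> Fix {mat 1} - L_set Tetra {mat 1} \<longleftrightarrow> (\<forall>g\<in>tetra. g \<noteq> mat 1 \<longrightarrow> g *v x \<noteq> x)" for x
    by (auto simp: Fix_def L_set_def)
  moreover have "point_stabilizer x = {mat 1} \<longleftrightarrow> (\<forall>g\<in>tetra. g \<noteq> mat 1 \<longrightarrow> g *v x \<noteq> x)" for x
    using one_in_tetra by (auto simp: point_stabilizer_def)
  ultimately show ?thesis by blast
qed

text \<open>The substantial point is condition (d). Complex hyperplanes can be bypassed, so a curve
  of points with trivial stabilizer joins a point to its image under \<open>mkappa\<close>.\<close>

lemma Z2_kappa_conditions: "H_mod_K_conditions Tetra Z2_kappa {mat 1}"
  unfolding H_mod_K_conditions_def
proof (intro conjI impI)
  interpret G: group "Tetra\<lparr>carrier := Z2_kappa\<rparr>" by (rule T.subgroup_imp_group[OF subgroup_Z2_kappa])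
  show "subgroup Z2_kappa Tetra" by (rule subgroup_Z2_kappa)
  show "subgroup {mat 1} Tetra" using T.triv_subgroup by simp
  show "{mat 1} \<subseteq> Z2_kappa" by (simp add: Z2_kappa_eq mat_1_sp)
  show "{mat 1} \<lhd> Tetra\<lparr>carrier := Z2_kappa\<rparr>" using G.one_is_normal by simp
  have "subgroup_generated Tetra {mkappa} = Tetra\<lparr>carrier := Z2_kappa\<rparr>"
    using generators_tetra(3) by (simp add: subgroup_generated_def Z2_kappa_def)
  then show "cyclic_group (Tetra\<lparr>carrier := Z2_kappa\<rparr> Mod {mat 1})"
    using T.cyclic_group_generated[of mkappa] cyclic_mod_trivial[OF subgroup_Z2_kappa] by simp
  show "isotropy_subgroup {mat 1} Tetra"
    using stabilizers_012(2) unfolding isotropy_subgroup_def stabilizer_def point_stabilizer_def by auto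
  have "Fix {mat 1} = (UNIV :: (complex^3) set)" by (simp add: Fix_def)
  then have dim: "dim (Fix {mat 1} :: (complex^3) set) = 6" by simp
  then show "2 \<le> dim (Fix {mat 1} :: (complex^3) set)" by simp
  show "Z2_kappa = {mat 1} \<or> Z2_kappa = normalizer Tetra {mat 1}"
    if "dim (Fix {mat 1} :: (complex^3) set) = 2" using that dim by simp
  let ?S = "Fix {mat 1} - L_set Tetra {mat 1}"
  \<comment> \<open>A loop through (0, 1, 2) at angle 0 and (0, 2, 1) at angle \<open>pi\<close>,
    which \<open>mkappa\<close> exchanges. The third coordinate minus the second is
    \<open>cis \<theta>\<close>, so the loop goes around the mirror of
    \<open>mkappa\<close>.\<close>
  define p where "p \<theta> = (vector [0, 3/2 - cis \<theta> / 2, 3/2 + cis \<theta> / 2] :: complex^3)" for \<theta>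
  define C where "C = connected_component_set ?S (p 0)"
  have p: "p \<theta> \<in> ?S" for \<theta>
  proof -
    have "\<bar>cos \<theta>\<bar> \<le> 1" by simp
    then have "cos \<theta> \<noteq> 3" "cos \<theta> \<noteq> - 3" "- cos \<theta> \<noteq> 3" by linarith+
    then have "cis \<theta> \<noteq> 3" "cis \<theta> \<noteq> - 3" "- cis \<theta> \<noteq> 3" "3/2 + cis \<theta> / 2 \<noteq> 0"
      by (auto simp: complex_eq_iff)
    moreover have "cis \<theta> \<noteq> 0" by (rule cis_neq_zero)
    ultimately show ?thesis
      unfolding Fix_minus_L_trivial mem_Collect_eq
      by (intro point_stabilizer_generic) (auto simp: p_def algebra_simps)
  qed
  have "continuous_on UNIV p"
  proof -
    have p_eq: "p = (\<lambda>\<theta>. axis 2 (3/2 - cis \<theta> / 2) + axis 3 (3/2 + cis \<theta> / 2))"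
      by (auto simp: p_def fun_eq_iff vector_3_eq_iff axis_def)
    have axis: "continuous_on UNIV (\<lambda>\<theta>. axis i (h \<theta>) :: complex^3)"
      if "continuous_on UNIV h" for i and h :: "real \<Rightarrow> complex"
    proof -
      have "bounded_linear (axis i :: complex \<Rightarrow> complex^3)"
        by (intro linear_conv_bounded_linear[THEN iffD1] linearI) (auto simp: vec_eq_iff axis_def)
      then show ?thesis using that by (rule bounded_linear.continuous_on)
    qed
    show ?thesis
      unfolding p_eq by (intro continuous_on_add axis continuous_intros) simp_all
  qed
  then have "connected (range p)" by (rule connected_continuous_image) simp
  then have "range p \<subseteq> C"
    unfolding C_def using p by (intro connected_component_maximal) auto
  moreover have "mkappa *v p 0 = p pi"
    by (simp add: p_def generators_sp sp_apply vector_3_eq_iff)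
  ultimately have kp: "mkappa *v p 0 \<in> C" by auto
  \<comment> \<open>The image of \<open>C\<close> is connected, stays in \<open>?S\<close> and meets
    \<open>C\<close> at \<open>mkappa *v p 0\<close>.\<close>
  have sub: "(*v) mkappa ` C \<subseteq> C"
  proof -
    have "connected ((*v) mkappa ` C)"
      unfolding C_def
      by (intro connected_continuous_image linear_continuous_on bounded_linear_matrix_vector_mult
          connected_connected_component)
    moreover have "(*v) mkappa ` C \<subseteq> ?S"
    proof -
      have "mkappa *v z \<in> ?S" if "z \<in> ?S" for z
        using that point_stabilizer_image[OF generators_tetra(3), of z] generators_tetra(3)
        unfolding Fix_minus_L_trivial by (simp add: conj_set_def)
      moreover have "C \<subseteq> ?S" unfolding C_def by (rule connected_component_subset)
      ultimately show ?thesis by blast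
    qed
    moreover have "p 0 \<in> C" unfolding C_def using p by simp
    ultimately have "(*v) mkappa ` C \<subseteq> connected_component_set ?S (mkappa *v p 0)"
      by (intro connected_component_maximal) auto
    also have "\<dots> = C"
      using kp unfolding C_def by (metis connected_component_eq)
    finally show ?thesis .
  qed
  \<comment> \<open>For an involution the inclusion is already an equality.\<close>
  have "mkappa *v (mkappa *v z) = z" for z
    by (simp add: generators_sp sp_apply vector_3_eq_iff)
  then have "(*v) mkappa ` C = C" using sub by (metis image_subset_iff subsetI subset_antisym image_eqI)
  moreover have "(*v) (mat 1) ` C = C" by (simp add: matrix_vector_mul_lid[abs_def])
  ultimately have "\<forall>h\<in>Z2_kappa. (*v) h ` C = C"
    by (simp add: Z2_kappa_eq mat_1_sp generators_sp)
  moreover have "C \<in> components ?S" unfolding C_def using p by (rule componentsI)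
  ultimately show "\<exists>C\<in>components ?S. \<forall>h\<in>Z2_kappa. (*v) h ` C = C" by blast
qed

section \<open>Assembling the classification\<close>

lemma conditions_core:
  assumes "H_mod_K_conditions Tetra H K"
  shows "conditions_core H K"
proof -
  have H: "subgroup H Tetra" "K \<subseteq> H" "K \<lhd> Tetra\<lparr>carrier := H\<rparr>"
    using assms by (auto simp: H_mod_K_conditions_def)
  have "\<exists>k'\<in>K. k ** h = h ** k'" if "h \<in> H" "k \<in> K" for h k
  proof -
    have "K #>\<^bsub>Tetra\<lparr>carrier := H\<rparr>\<^esub> h = h <#\<^bsub>Tetra\<lparr>carrier := H\<rparr>\<^esub> K"
      using normal.coset_eq[OF H(3)] that(1) by simp
    moreover have "k ** h \<in> K #>\<^bsub>Tetra\<lparr>carrier := H\<rparr>\<^esub> h"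
      using that(2) by (auto simp: r_coset_def)
    ultimately show ?thesis by (auto simp: l_coset_def)
  qed
  then show ?thesis using H by (simp add: conditions_core_def)
qed

text \<open>For trivial \<open>K\<close> the group \<open>H\<close> is itself cyclic and its
  generator decides; for nontrivial \<open>K\<close> normality restricts \<open>H\<close>.\<close>

lemma classification:
  assumes cond: "H_mod_K_conditions Tetra H K" and ne: "H \<noteq> {mat 1}"
  shows "\<exists>g\<in>tetra. exceptional (conj_set g H) (conj_set g K) \<or>
    (\<exists>v. v \<noteq> 0 \<and> conj_set g H = circle_stabilizer v \<and> conj_set g K = point_stabilizer v)"
proof -
  have H: "subgroup H Tetra" and cyc: "cyclic_group (Tetra\<lparr>carrier := H\<rparr> Mod K)"
    and dim: "dim (Fix K) \<ge> 2"
    using cond by (auto simp: H_mod_K_conditions_def)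
  obtain x where K: "K = point_stabilizer x"
    using cond by (auto simp: H_mod_K_conditions_def isotropy_subgroup_def stabilizer_def point_stabilizer_def)
  show ?thesis
  proof (cases "K = {mat 1}")
    case True
    interpret G: group "Tetra\<lparr>carrier := H\<rparr>" by (rule T.subgroup_imp_group[OF H])
    have "cyclic_group (Tetra\<lparr>carrier := H\<rparr>)"
      using cyc cyclic_mod_trivial[OF H] by (simp add: True)
    then obtain h where h: "h \<in> H" "subgroup_generated (Tetra\<lparr>carrier := H\<rparr>) {h} = Tetra\<lparr>carrier := H\<rparr>"
      unfolding cyclic_group_def by auto
    have "generate (Tetra\<lparr>carrier := H\<rparr>) {h} = H"
      using arg_cong[OF h(2), of carrier] h(1) by (simp add: carrier_subgroup_generated)
    then have gen: "generate Tetra {h} = H"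
      using T.generate_consistent[of "{h}" H] h(1) H by simp
    have "h \<in> tetra" using h(1) subgroup.subset[OF H] by auto
    from classify_cyclic[OF this] show ?thesis using ne by (simp add: gen True)
  next
    case False
    \<comment> \<open>The stabilizer of 0 is the whole group, whose fixed space is 0, against the
      dimension bound in condition (c).\<close>
    have "x \<noteq> 0"
    proof
      assume "x = 0"
      then have Kt: "K = tetra" by (simp add: K point_stabilizer_def)
      have "Fix K \<subseteq> {0}"
      proof
        fix y assume y: "y \<in> Fix K"
        have "sp 1 1 (-1) 2 (-1) 3 *v y = y" "sp (-1) 1 (-1) 2 1 3 *v y = y"
          using y unfolding Fix_def Kt by (auto intro!: tetraI)
        then show "y \<in> {0}" by (auto simp: sp_apply vector_3_eq_iff vec_eq_iff[of y] forall_3)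
      qed
      then have "dim (Fix K) = 0" by (simp only: dim_eq_0)
      then show False using dim by linarith
    qed
    then show ?thesis
      using classify_nonregular conditions_core[OF cond] False unfolding K by blast
  qed
qed

text \<open>The definition conjugates the listed pair into \<open>(H, K)\<close>, the classification
  conjugates \<open>(H, K)\<close>; passing to inverses exchanges the two directions.\<close>

lemma conjugate_pairs_iff:
  "conjugate_pairs Tetra (H, K) (H', K') \<longleftrightarrow> (\<exists>g\<in>tetra. conj_set g H = H' \<and> conj_set g K = K')"
proof -
  have "conjugate_pairs Tetra (H, K) (H', K') \<longleftrightarrow> (\<exists>g\<in>tetra. H = conj_set g H' \<and> K = conj_set g K')"
    by (simp add: conjugate_pairs_def conj_set_coset)
  also have "\<dots> \<longleftrightarrow> (\<exists>g\<in>tetra. conj_set g H = H' \<and> conj_set g K = K')"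
    using conj_set_inverse tinv(1) by metis
  finally show ?thesis .
qed

text \<open>Occurrence is invariant under conjugation, so the alternative in
  \<open>classification\<close> decides it.\<close>

lemma occurs_iff:
  assumes "H_mod_K_conditions Tetra H K" "H \<noteq> {mat 1}"
  shows "occurs_at_primary_Hopf Tetra H K \<longleftrightarrow>
    \<not> (\<exists>g\<in>tetra. exceptional (conj_set g H) (conj_set g K))"
proof
  assume "occurs_at_primary_Hopf Tetra H K"
  then show "\<not> (\<exists>g\<in>tetra. exceptional (conj_set g H) (conj_set g K))"
    using occurs_conj D2_not_occurs Z2_kappa_not_occurs unfolding exceptional_def by metis
next
  assume "\<not> (\<exists>g\<in>tetra. exceptional (conj_set g H) (conj_set g K))"
  then obtain g v where "g \<in> tetra" "v \<noteq> 0" "conj_set g H = circle_stabilizer v"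
    "conj_set g K = point_stabilizer v"
    using classification[OF assms] by blast
  then show "occurs_at_primary_Hopf Tetra H K"
    using occurs_stabilizers occurs_conj_iff by metis
qed

theorem proposition1:
  "group Tetra \<and> card (carrier Tetra) = 24 \<and>
   (\<forall>H K. H_mod_K_conditions Tetra H K \<and> H \<noteq> trivial_subgroup Tetra \<longrightarrow>
      (occurs_at_primary_Hopf Tetra H K \<longleftrightarrow>
         \<not> conjugate_pairs Tetra (H, K) (D2, D2) \<and>
         \<not> conjugate_pairs Tetra (H, K) (Z2_kappa, trivial_subgroup Tetra))) \<and>
   H_mod_K_conditions Tetra D2 D2 \<and>
   \<not> occurs_at_primary_Hopf Tetra D2 D2 \<and>
   H_mod_K_conditions Tetra Z2_kappa (trivial_subgroup Tetra) \<and>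
   \<not> occurs_at_primary_Hopf Tetra Z2_kappa (trivial_subgroup Tetra)"
proof -
  have triv: "trivial_subgroup Tetra = {mat 1}" by (simp add: trivial_subgroup_def)
  show ?thesis
    unfolding triv conjugate_pairs_iff
    using group_Tetra card_tetra occurs_iff D2_conditions D2_not_occurs
      Z2_kappa_conditions Z2_kappa_not_occurs
    by (auto simp: exceptional_def)
qed

end
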